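(* Consider the networked estimation problem described in the context, with data $T,B,n_1,n_2,\pi_1,\pi_2,p_Z,c$. Suppose that $\pi_1$ is symmetric and unimodal around $a^1\in\mathbb{R}^{n_1}$ and $\pi_2$ is symmetric and unimodal around $a^2\in\mathbb{R}^{n_2}$. Then there exist functions $\tau^\star_t:\mathbb{Z}\to\mathbb{R}$, $t\in\{1,\dots,T\}$, such that the following strategy profile $(\mathbf{f}^\star,\mathbf{g}^{1\star},\mathbf{g}^{2\star})$ is globally optimal, i.e., $\mathcal{J}(\mathbf{f}^\star,\mathbf{g}^{1\star},\mathbf{g}^{2\star})\le \mathcal{J}(\mathbf{f},\mathbf{g}^1,\mathbf{g}^2)$ for every admissible scheduling strategy $\mathbf{f}$ and all admissible estimation strategies $\mathbf{g}^1,\mathbf{g}^2$. The scheduler uses $U_t=f^\star_t(\mathbf{X}_t,E_t)$, where, for $\mathbf{x}=(x^1,x^2)\in\mathbb{R}^{n_1}\times\mathbb{R}^{n_2}$ and $e\in\{1,\dots,B\}$, $$f^\star_t(\mathbf{x},e)=\begin{cases}0 & \text{if } \max_{i\in\{1,2\}}\|x^i-a^i\|\le \tau^\star_t(e),\\ \arg\max_{i\in\{1,2\}}\|x^i-a^i\| & \text{otherwise,}\end{cases}$$ and $f^\star_t(\mathbf{x},0)=0$. For $i\in\{1,2\}$, estimator $i$ uses $\hat X^i_t=g^{i\star}_t(Y^i_t)$, where $$g^{i\star}_t(y^i)=\begin{cases}x^i & \text{if } y^i=x^i\in\mathbb{R}^{n_i},\\ a^i & \text{if } y^i=\varnothing.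\end{cases}$$
   Context: Symmetric and unimodal: a probability density function $\pi:\mathbb{R}^n\to\mathbb{R}$ is symmetric and unimodal around $a\in\mathbb{R}^n$ if $\|x-a\|\le\|y-a\|$ implies $\pi(x)\ge\pi(y)$ for all $x,y\in\mathbb{R}^n$ (Euclidean norm). Convention: $\arg\max$ over a finite set of indices denotes the smallest maximizing index. Model. Let $T,B\in\mathbb{N}$ with $1\le B<T$, and $c\ge 0$. For $i\in\{1,2\}$ the source $X^i_t\in\mathbb{R}^{n_i}$, $t\in\{1,\dots,T\}$, is i.i.d. in time with pdf $\pi_i$; the two source processes are independent of each other. The harvested energies $Z_t\in\mathbb{Z}_{\ge0}$ are i.i.d. in time with probability mass function $p_Z$, independent of the sources. Write $\mathbf{X}_t=(X^1_t,X^2_t)$ and $\mathbf{Y}_t=(Y^1_t,Y^2_t)$; subscripts $a\!:\!b$ denote the tuple of variables with indices $a,\dots,b$. The battery level satisfies $E_1=B$ and $E_{t+1}=\min\{E_t-\mathbb{I}(U_t\neq0)+Z_t,\,B\}$ for $t\in\{1,\dots,T-1\}$, where the scheduling decision $U_t$ must lie in $\mathbb{U}(E_t)$, with $\mathbb{U}(e)=\{0,1,2\}$ if $e>0$ and $\mathbb{U}(0)=\{0\}$. Estimator $i$ observes $Y^i_t=X^i_t$ if $U_t=i$ and $Y^i_t=\varnothing$ (a no-packet symbol not in $\mathbb{R}^{n_i}$) if $U_t\ne i$. Admissible strategies. A scheduling strategy is $\mathbf{f}=(f_1,\dots,f_T)$ with measurable $f_t$ and $U_t=f_t(\mathbf{X}_{1:t},E_{1:t},\mathbf{Y}_{1:t-1})\in\mathbb{U}(E_t)$.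 An estimation strategy for estimator $i$ is $\mathbf{g}^i=(g^i_1,\dots,g^i_T)$ with measurable $g^i_t$ and $\hat X^i_t=g^i_t(Y^i_{1:t})\in\mathbb{R}^{n_i}$. Cost: $$\mathcal{J}(\mathbf{f},\mathbf{g}^1,\mathbf{g}^2)=\sum_{t=1}^T\mathbb{E}\Big[\sum_{i\in\{1,2\}}\|X^i_t-\hat X^i_t\|^2+c\,\mathbb{I}(U_t\ne0)\Big].$$ *)

theory Defs
  imports "HOL-Probability.Probability"
begin

definition is_pdf :: "('a::euclidean_space \<Rightarrow> real) \<Rightarrow> bool" where
  "is_pdf p \<longleftrightarrow> p \<in> borel_measurable borel \<and> (\<forall>x. 0 \<le> p x) \<and> (\<integral>\<^sup>+x. ennreal (p x) \<partial>lborel) = 1"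

definition symmetric_unimodal :: "('a::euclidean_space \<Rightarrow> real) \<Rightarrow> 'a \<Rightarrow> bool" where
  "symmetric_unimodal p a \<longleftrightarrow> (\<forall>x y. norm (x - a) \<le> norm (y - a) \<longrightarrow> p y \<le> p x)"

text \<open>
  The library's \<open>indep_var\<close> needs both variables to have the same type; here they may differ.
\<close>

definition (in prob_space) indep_rv ::
  "'b measure \<Rightarrow> ('a \<Rightarrow> 'b) \<Rightarrow> 'c measure \<Rightarrow> ('a \<Rightarrow> 'c) \<Rightarrow> bool" where
  "indep_rv N X K Y \<longleftrightarrow> random_variable N X \<and> random_variable K Y \<and>
     indep_set (sets (vimage_algebra (space M) X N)) (sets (vimage_algebra (space M) Y K))"

text \<open>
  The three processes are each i.i.d. over the horizon; independence between processes is
  independence of whole trajectories, and the energies are independent of the pair of sources.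
\<close>

locale energy_harvesting_model = prob_space M
  for M :: "'w measure" +
  fixes T :: nat
    and X1 :: "nat \<Rightarrow> 'w \<Rightarrow> 'a::euclidean_space"
    and X2 :: "nat \<Rightarrow> 'w \<Rightarrow> 'b::euclidean_space"
    and Z :: "nat \<Rightarrow> 'w \<Rightarrow> nat"
    and \<pi>1 :: "'a \<Rightarrow> real"
    and \<pi>2 :: "'b \<Rightarrow> real"
    and pZ :: "nat pmf"
  assumes pdf1: "is_pdf \<pi>1"
    and pdf2: "is_pdf \<pi>2"
    and X1_density: "\<And>t. t \<in> {1..T} \<Longrightarrow> distributed M lborel (X1 t) (\<lambda>x. ennreal (\<pi>1 x))"
    and X2_density: "\<And>t. t \<in> {1..T} \<Longrightarrow> distributed M lborel (X2 t) (\<lambda>x. ennreal (\<pi>2 x))"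
    and Z_distr: "\<And>t. t \<in> {1..T} \<Longrightarrow> distr M (count_space UNIV) (Z t) = measure_pmf pZ"
    and X1_indep: "indep_vars (\<lambda>_. borel) X1 {1..T}"
    and X2_indep: "indep_vars (\<lambda>_. borel) X2 {1..T}"
    and Z_indep: "indep_vars (\<lambda>_. count_space UNIV) Z {1..T}"
    and X1_X2_indep:
      "indep_rv (PiM {1..T} (\<lambda>_. borel)) (\<lambda>\<omega>. \<lambda>t\<in>{1..T}. X1 t \<omega>)
                (PiM {1..T} (\<lambda>_. borel)) (\<lambda>\<omega>. \<lambda>t\<in>{1..T}. X2 t \<omega>)"
    and sources_Z_indep:
      "indep_rv (PiM {1..T} (\<lambda>_. borel) \<Otimes>\<^sub>M PiM {1..T} (\<lambda>_. borel))
                (\<lambda>\<omega>. (\<lambda>t\<in>{1..T}. X1 t \<omega>, \<lambda>t\<in>{1..T}. X2 t \<omega>))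
                (PiM {1..T} (\<lambda>_. count_space UNIV)) (\<lambda>\<omega>. \<lambda>t\<in>{1..T}. Z t \<omega>)"

text \<open>
  The no-packet symbol is \<^term>\<open>None\<close>. Observations carry the disjoint-union
  \<open>\<sigma>\<close>-algebra of the Borel sets and the additional point.
\<close>

definition obs_borel :: "'a::topological_space option measure" where
  "obs_borel = sigma UNIV {S. Some -` S \<in> sets borel}"

lemma sets_obs_borel:
  "sets (obs_borel :: 'a::topological_space option measure) = {S. Some -` S \<in> sets borel}"
proof -
  have "sigma_algebra UNIV {S :: 'a option set. Some -` S \<in> sets borel}"
    by (auto simp: sigma_algebra_iff2 vimage_Compl Compl_eq_Diff_UNIV[symmetric] vimage_UN)
  then show ?thesis
    unfolding obs_borel_def by (simp add: sigma_algebra.sigma_sets_eq)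
qed

lemma space_obs_borel: "space obs_borel = UNIV"
  by (simp add: obs_borel_def)

definition observe :: "nat \<Rightarrow> nat \<Rightarrow> 'a \<Rightarrow> 'a option" where
  "observe i u x = (if u = i then Some x else None)"

definition decisions :: "nat \<Rightarrow> nat set" where
  "decisions e = (if e > 0 then {0, 1, 2} else {0})"

text \<open>
  A scheduler at time \<open>t\<close> reads the source values at \<open>1..t\<close>, the battery levels at \<open>1..t\<close> and
  the observations at \<open>1..t-1\<close>; finite tuples are functions on \<^typ>\<open>nat\<close> that are
  \<^const>\<open>undefined\<close> outside the index range, as in \<^const>\<open>PiM\<close>.
\<close>

type_synonym ('a, 'b) scheduler =
  "nat \<Rightarrow> (nat \<Rightarrow> 'a \<times> 'b) \<times> (nat \<Rightarrow> nat) \<times> (nat \<Rightarrow> 'a option \<times> 'b option) \<Rightarrow> nat"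

type_synonym 'a estimator = "nat \<Rightarrow> (nat \<Rightarrow> 'a option) \<Rightarrow> 'a"

lemma restrict_fundef_cong [fundef_cong]:
  "I = J \<Longrightarrow> (\<And>i. i \<in> J \<Longrightarrow> f i = g i) \<Longrightarrow> restrict f I = restrict g J"
  by (auto simp: restrict_def)

text \<open>
  Battery level and decision along the sample path \<open>x\<close>, \<open>z\<close>. Time starts at 1; the value of
  \<open>battery\<close> at time 0 is a dummy. Natural subtraction never truncates under a scheduler
  that respects \<^const>\<open>decisions\<close>.
\<close>

function (sequential)
  battery :: "nat \<Rightarrow> ('a, 'b) scheduler \<Rightarrow> (nat \<Rightarrow> 'a \<times> 'b) \<Rightarrow> (nat \<Rightarrow> nat) \<Rightarrow> nat \<Rightarrow> nat" and
  decision :: "nat \<Rightarrow> ('a, 'b) scheduler \<Rightarrow> (nat \<Rightarrow> 'a \<times> 'b) \<Rightarrow> (nat \<Rightarrow> nat) \<Rightarrow> nat \<Rightarrow> nat"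
where
  "battery B f x z 0 = B"
| "battery B f x z (Suc 0) = B"
| "battery B f x z (Suc (Suc t)) =
     min (battery B f x z (Suc t) - (if decision B f x z (Suc t) \<noteq> 0 then 1 else 0) + z (Suc t)) B"
| "decision B f x z t =
     f t (\<lambda>s\<in>{1..t}. x s,
          \<lambda>s\<in>{1..t}. battery B f x z s,
          \<lambda>s\<in>{1..t - 1}. (observe 1 (decision B f x z s) (fst (x s)),
                          observe 2 (decision B f x z s) (snd (x s))))"
  by pat_completeness auto
termination
  by (relation "Wellfounded.measure (case_sum (\<lambda>(B, f, x, z, t). 2 * t) (\<lambda>(B, f, x, z, t). 2 * t + 1))") auto

text \<open>The defining equation of \<^const>\<open>decision\<close> is unconditional and would loop.\<close>

declare decision.simps [simp del]

definition battery_rv where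
  "battery_rv B X1 X2 Z f t \<omega> = battery B f (\<lambda>s. (X1 s \<omega>, X2 s \<omega>)) (\<lambda>s. Z s \<omega>) t"

definition decision_rv where
  "decision_rv B X1 X2 Z f t \<omega> = decision B f (\<lambda>s. (X1 s \<omega>, X2 s \<omega>)) (\<lambda>s. Z s \<omega>) t"

definition estimate1_rv where
  "estimate1_rv B X1 X2 Z f g t \<omega> =
     g t (\<lambda>s\<in>{1..t}. observe 1 (decision_rv B X1 X2 Z f s \<omega>) (X1 s \<omega>))"

definition estimate2_rv where
  "estimate2_rv B X1 X2 Z f g t \<omega> =
     g t (\<lambda>s\<in>{1..t}. observe 2 (decision_rv B X1 X2 Z f s \<omega>) (X2 s \<omega>))"

definition admissible_scheduler ::
  "'w measure \<Rightarrow> nat \<Rightarrow> nat \<Rightarrow> (nat \<Rightarrow> 'w \<Rightarrow> 'a::euclidean_space) \<Rightarrow> (nat \<Rightarrow> 'w \<Rightarrow> 'b::euclidean_space)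
    \<Rightarrow> (nat \<Rightarrow> 'w \<Rightarrow> nat) \<Rightarrow> ('a, 'b) scheduler \<Rightarrow> bool" where
  "admissible_scheduler M T B X1 X2 Z f \<longleftrightarrow>
     (\<forall>t\<in>{1..T}.
        f t \<in> measurable (PiM {1..t} (\<lambda>_. borel \<Otimes>\<^sub>M borel) \<Otimes>\<^sub>M PiM {1..t} (\<lambda>_. count_space UNIV)
                            \<Otimes>\<^sub>M PiM {1..t - 1} (\<lambda>_. obs_borel \<Otimes>\<^sub>M obs_borel))
                         (count_space UNIV) \<and>
        (\<forall>\<omega>\<in>space M. decision_rv B X1 X2 Z f t \<omega> \<in> decisions (battery_rv B X1 X2 Z f t \<omega>)))"

definition admissible_estimator :: "nat \<Rightarrow> 'a::euclidean_space estimator \<Rightarrow> bool" where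
  "admissible_estimator T g \<longleftrightarrow>
     (\<forall>t\<in>{1..T}. g t \<in> measurable (PiM {1..t} (\<lambda>_. obs_borel)) borel)"

text \<open>The stage costs are nonnegative, so expectations are taken in \<open>[0, \<infinity>]\<close>; no second moments are assumed.\<close>

definition total_cost ::
  "'w measure \<Rightarrow> nat \<Rightarrow> nat \<Rightarrow> real \<Rightarrow> (nat \<Rightarrow> 'w \<Rightarrow> 'a::euclidean_space)
    \<Rightarrow> (nat \<Rightarrow> 'w \<Rightarrow> 'b::euclidean_space) \<Rightarrow> (nat \<Rightarrow> 'w \<Rightarrow> nat)
    \<Rightarrow> ('a, 'b) scheduler \<Rightarrow> 'a estimator \<Rightarrow> 'b estimator \<Rightarrow> ennreal" where
  "total_cost M T B c X1 X2 Z f g1 g2 =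
     (\<Sum>t=1..T. \<integral>\<^sup>+\<omega>. ennreal
        ((norm (X1 t \<omega> - estimate1_rv B X1 X2 Z f g1 t \<omega>))\<^sup>2
         + (norm (X2 t \<omega> - estimate2_rv B X1 X2 Z f g2 t \<omega>))\<^sup>2
         + c * (if decision_rv B X1 X2 Z f t \<omega> \<noteq> 0 then 1 else 0)) \<partial>M)"

definition first_argmax :: "nat set \<Rightarrow> (nat \<Rightarrow> real) \<Rightarrow> nat" where
  "first_argmax I h = (LEAST i. i \<in> I \<and> (\<forall>j\<in>I. h j \<le> h i))"

definition deviation :: "'a::euclidean_space \<Rightarrow> 'b::euclidean_space \<Rightarrow> 'a \<times> 'b \<Rightarrow> nat \<Rightarrow> real" where
  "deviation a1 a2 x i = (if i = 1 then norm (fst x - a1) else norm (snd x - a2))"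

definition threshold_rule ::
  "'a::euclidean_space \<Rightarrow> 'b::euclidean_space \<Rightarrow> (nat \<Rightarrow> int \<Rightarrow> real) \<Rightarrow> nat \<Rightarrow> 'a \<times> 'b \<Rightarrow> nat \<Rightarrow> nat" where
  "threshold_rule a1 a2 \<tau> t x e =
     (if e = 0 then 0
      else if (MAX i\<in>{1, 2}. deviation a1 a2 x i) \<le> \<tau> t (int e) then 0
      else first_argmax {1, 2} (deviation a1 a2 x))"

definition threshold_scheduler ::
  "'a::euclidean_space \<Rightarrow> 'b::euclidean_space \<Rightarrow> (nat \<Rightarrow> int \<Rightarrow> real) \<Rightarrow> ('a, 'b) scheduler" where
  "threshold_scheduler a1 a2 \<tau> t = (\<lambda>(x, e, y). threshold_rule a1 a2 \<tau> t (x t) (e t))"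

definition default_estimator :: "'a \<Rightarrow> 'a estimator" where
  "default_estimator a t y = (case y t of Some x \<Rightarrow> x | None \<Rightarrow> a)"

end

theory Submission
  imports Defs
begin

text \<open>
  Given the past, the battery level and the estimates announced after a missing packet are
  constants, while the current sources are fresh. So the cost of a stage plus the cost to go
  is at least the expectation of \<open>min (d1 + d2 + C0) (c + min d1 d2 + C1)\<close>, where \<open>d1\<close>, \<open>d2\<close>
  are the squared distances of the sources to those constants and \<open>C0\<close>, \<open>C1\<close> the expected
  costs to go after staying idle and after transmitting. This is nondecreasing in \<open>d1\<close> and
  \<open>d2\<close>, hence by symmetry and unimodality the constants \<open>a1\<close>, \<open>a2\<close> are optimal whatever the
  past is, and the minimum is attained by transmitting the larger deviation exactly if its
  square exceeds \<open>c + C1 - C0\<close>. Backward induction over time gives the theorem.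
\<close>

subsection \<open>Independence\<close>

text \<open>The estimators do not see the battery, and silence itself carries information about the
  sources, so scheduling and estimation do not separate a priori. Reasoning about beliefs is
  avoided: once the past is frozen, the two no-packet estimates are fixed points, whatever part of
  the past they use, and the scheduler may be granted the pointwise best decision against them. The
  comparison needs only that this best response is monotone in the two distances, so the bound holds
  against joint changes of scheduler and estimators, not merely against changes by one of them.
  Freezing the past is meant literally: the processes are moved to a finite product measure, and
  iterated integrals take the place of conditional expectations. As second moments may be infinite,
  costs to go may be infinite too; differences such as \<open>C1 - C0\<close> then lose their
  meaning, which shapes the treatment of the thresholds.\<close>

lemma (in prob_space) indep_rv_measurable:
  assumes "indep_rv N X K Y"
  shows "X \<in> measurable M N" "Y \<in> measurable M K"
  using assms by (auto simp: indep_rv_def)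

lemma (in prob_space) indep_rv_prob:
  assumes "indep_rv N X K Y" "A \<in> sets N" "C \<in> sets K"
  shows "prob ((X -` A \<inter> space M) \<inter> (Y -` C \<inter> space M)) =
    prob (X -` A \<inter> space M) * prob (Y -` C \<inter> space M)"
  using assms by (auto simp: indep_rv_def intro!: indep_setD in_vimage_algebra)

lemma (in prob_space) indep_rvI:
  assumes [measurable]: "X \<in> measurable M N" "Y \<in> measurable M K"
    and prob: "\<And>A C. A \<in> sets N \<Longrightarrow> C \<in> sets K \<Longrightarrow>
      prob ((X -` A \<inter> space M) \<inter> (Y -` C \<inter> space M)) =
      prob (X -` A \<inter> space M) * prob (Y -` C \<inter> space M)"
  shows "indep_rv N X K Y"
  unfolding indep_rv_def indep_sets2_eq
  using assms by (auto simp: sets_vimage_algebra2[OF measurable_space[OF assms(1), THEN funcsetI]]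
      sets_vimage_algebra2[OF measurable_space[OF assms(2), THEN funcsetI]])

lemma (in prob_space) indep_rv_compose:
  assumes ind: "indep_rv N X K Y"
    and [measurable]: "f \<in> measurable N N'" "g \<in> measurable K K'"
  shows "indep_rv N' (\<lambda>\<omega>. f (X \<omega>)) K' (\<lambda>\<omega>. g (Y \<omega>))"
proof (rule indep_rvI)
  note [measurable] = indep_rv_measurable[OF ind]
  show "(\<lambda>\<omega>. f (X \<omega>)) \<in> measurable M N'" "(\<lambda>\<omega>. g (Y \<omega>)) \<in> measurable M K'"
    by measurable
  fix A C assume [measurable]: "A \<in> sets N'" "C \<in> sets K'"
  have "(\<lambda>\<omega>. f (X \<omega>)) -` A \<inter> space M = X -` (f -` A \<inter> space N) \<inter> space M"
    "(\<lambda>\<omega>. g (Y \<omega>)) -` C \<inter> space M = Y -` (g -` C \<inter> space K) \<inter> space M"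
    using indep_rv_measurable[OF ind, THEN measurable_space] by auto
  moreover have "f -` A \<inter> space N \<in> sets N" "g -` C \<inter> space K \<in> sets K"
    by measurable
  ultimately show "prob ((\<lambda>\<omega>. f (X \<omega>)) -` A \<inter> space M \<inter> ((\<lambda>\<omega>. g (Y \<omega>)) -` C \<inter> space M)) =
      prob ((\<lambda>\<omega>. f (X \<omega>)) -` A \<inter> space M) * prob ((\<lambda>\<omega>. g (Y \<omega>)) -` C \<inter> space M)"
    by (simp only: indep_rv_prob[OF ind])
qed

lemma (in prob_space) indep_rv_distr_Pair:
  assumes ind: "indep_rv N X K Y"
  shows "distr M (N \<Otimes>\<^sub>M K) (\<lambda>\<omega>. (X \<omega>, Y \<omega>)) = distr M N X \<Otimes>\<^sub>M distr M K Y"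
proof (rule sym, rule pair_measure_eqI)
  note [measurable] = indep_rv_measurable[OF ind]
  interpret X: prob_space "distr M N X" by (rule prob_space_distr) measurable
  interpret Y: prob_space "distr M K Y" by (rule prob_space_distr) measurable
  show "sigma_finite_measure (distr M N X)" "sigma_finite_measure (distr M K Y)"
    by unfold_locales
  show "sets (distr M N X \<Otimes>\<^sub>M distr M K Y) = sets (distr M (N \<Otimes>\<^sub>M K) (\<lambda>\<omega>. (X \<omega>, Y \<omega>)))"
    by (simp cong: sets_pair_measure_cong)
  fix A C assume "A \<in> sets (distr M N X)" "C \<in> sets (distr M K Y)"
  then have [measurable]: "A \<in> sets N" "C \<in> sets K" by auto
  have "(\<lambda>\<omega>. (X \<omega>, Y \<omega>)) -` (A \<times> C) \<inter> space M = (X -` A \<inter> space M) \<inter> (Y -` C \<inter> space M)"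
    by auto
  then show "emeasure (distr M N X) A * emeasure (distr M K Y) C =
      emeasure (distr M (N \<Otimes>\<^sub>M K) (\<lambda>\<omega>. (X \<omega>, Y \<omega>))) (A \<times> C)"
    by (simp add: emeasure_distr emeasure_eq_measure indep_rv_prob[OF ind] ennreal_mult)
qed

text \<open>Rectangles form an intersection-stable generator of each product. On them the event
  splits into a box for one trajectory and a box for the other, and it factorises by independence of
  the trajectories and within each of them. Applied twice: to the two sources, then to the sources
  and the energies.\<close>

lemma (in prob_space) indep_vars_Pair:
  assumes I: "finite I" "I \<noteq> {}"
    and X: "indep_vars K X I" and Y: "indep_vars L Y I"
    and XY: "indep_rv (PiM I K) (\<lambda>\<omega>. \<lambda>i\<in>I. X i \<omega>) (PiM I L) (\<lambda>\<omega>. \<lambda>i\<in>I. Y i \<omega>)"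
  shows "indep_vars (\<lambda>i. K i \<Otimes>\<^sub>M L i) (\<lambda>i \<omega>. (X i \<omega>, Y i \<omega>)) I"
proof -
  let ?E = "\<lambda>i. {a \<times> b | a b. a \<in> sets (K i) \<and> b \<in> sets (L i)}"
  have rvX[measurable]: "X i \<in> measurable M (K i)" and rvY[measurable]: "Y i \<in> measurable M (L i)"
    if "i \<in> I" for i
    using X Y that by (auto simp: indep_vars_def)
  have XYi: "indep_rv (K i) (X i) (L i) (Y i)" if "i \<in> I" for i
    using indep_rv_compose[OF XY measurable_component_singleton[OF that]
        measurable_component_singleton[OF that]] that by simp
  have "prob (\<Inter>j\<in>I. (\<lambda>\<omega>. (X j \<omega>, Y j \<omega>)) -` A j \<inter> space M) =
      (\<Prod>j\<in>I. prob ((\<lambda>\<omega>. (X j \<omega>, Y j \<omega>)) -` A j \<inter> space M))" if A: "A \<in> (\<Pi> i\<in>I. ?E i)" for A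
  proof -
    have "\<forall>i\<in>I. \<exists>a b. A i = a \<times> b \<and> a \<in> sets (K i) \<and> b \<in> sets (L i)"
      using A by (auto simp: Pi_iff)
    then obtain a b where ab: "\<And>i. i \<in> I \<Longrightarrow> A i = a i \<times> b i"
        "\<And>i. i \<in> I \<Longrightarrow> a i \<in> sets (K i)" "\<And>i. i \<in> I \<Longrightarrow> b i \<in> sets (L i)"
      by metis
    have eq: "(\<lambda>\<omega>. (X j \<omega>, Y j \<omega>)) -` A j \<inter> space M = (X j -` a j \<inter> space M) \<inter> (Y j -` b j \<inter> space M)"
      if "j \<in> I" for j
      using ab(1)[OF that] by auto
    have X': "(\<lambda>\<omega>. \<lambda>i\<in>I. X i \<omega>) -` (PiE I a) \<inter> space M = (\<Inter>j\<in>I. X j -` a j \<inter> space M)"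
      and Y': "(\<lambda>\<omega>. \<lambda>i\<in>I. Y i \<omega>) -` (PiE I b) \<inter> space M = (\<Inter>j\<in>I. Y j -` b j \<inter> space M)"
      using I by (auto simp: PiE_iff)
    have "(\<Inter>j\<in>I. (\<lambda>\<omega>. (X j \<omega>, Y j \<omega>)) -` A j \<inter> space M) =
        ((\<lambda>\<omega>. \<lambda>i\<in>I. X i \<omega>) -` (PiE I a) \<inter> space M) \<inter> ((\<lambda>\<omega>. \<lambda>i\<in>I. Y i \<omega>) -` (PiE I b) \<inter> space M)"
      unfolding X' Y' using I eq by auto
    also have "prob \<dots> = prob ((\<lambda>\<omega>. \<lambda>i\<in>I. X i \<omega>) -` (PiE I a) \<inter> space M) *
        prob ((\<lambda>\<omega>. \<lambda>i\<in>I. Y i \<omega>) -` (PiE I b) \<inter> space M)"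
      using I ab by (intro indep_rv_prob[OF XY] sets_PiM_I_finite) auto
    also have "\<dots> = (\<Prod>j\<in>I. prob (X j -` a j \<inter> space M)) * (\<Prod>j\<in>I. prob (Y j -` b j \<inter> space M))"
      unfolding X' Y' by (intro arg_cong2[where f = times] indep_varsD_finite[OF X] indep_varsD_finite[OF Y] I ab)
    also have "\<dots> = (\<Prod>j\<in>I. prob ((\<lambda>\<omega>. (X j \<omega>, Y j \<omega>)) -` A j \<inter> space M))"
      unfolding prod.distrib[symmetric]
      by (intro prod.cong refl) (simp only: eq indep_rv_prob[OF XYi ab(2,3)])
    finally show ?thesis .
  qed
  moreover have "sets (K i \<Otimes>\<^sub>M L i) = sigma_sets (space (K i \<Otimes>\<^sub>M L i)) (?E i)" for i
    by (simp add: sets_pair_measure space_pair_measure)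
  moreover have "space (K i \<Otimes>\<^sub>M L i) \<in> ?E i" for i
    by (auto simp: space_pair_measure)
  moreover have "?E i \<subseteq> Pow (space (K i \<Otimes>\<^sub>M L i))" for i
    by (auto simp: space_pair_measure dest: sets.sets_into_space)
  moreover have "(\<lambda>\<omega>. (X i \<omega>, Y i \<omega>)) \<in> measurable M (K i \<Otimes>\<^sub>M L i)" if "i \<in> I" for i
    using that by measurable
  ultimately show ?thesis
    using I by (subst indep_vars_finite[where E = ?E]) (auto intro!: Int_stable_pair_measure_generator)
qed

section \<open>Law of the sample path\<close>

context energy_harvesting_model
begin

definition source_law :: "('a \<times> 'b) measure" where
  "source_law = density lborel (\<lambda>x. ennreal (\<pi>1 x)) \<Otimes>\<^sub>M density lborel (\<lambda>x. ennreal (\<pi>2 x))"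

definition step_law :: "(('a \<times> 'b) \<times> nat) measure" where
  "step_law = source_law \<Otimes>\<^sub>M measure_pmf pZ"

lemma sets_source_law[measurable_cong]: "sets source_law = sets (borel \<Otimes>\<^sub>M borel)"
  unfolding source_law_def by (intro sets_pair_measure_cong) simp_all

lemma sets_step_law[measurable_cong]: "sets step_law = sets ((borel \<Otimes>\<^sub>M borel) \<Otimes>\<^sub>M count_space UNIV)"
  unfolding step_law_def by (intro sets_pair_measure_cong sets_source_law) simp_all

lemma prob_space_density_pdf: "is_pdf p \<Longrightarrow> prob_space (density lborel (\<lambda>x. ennreal (p x)))"
  by (rule prob_spaceI) (auto simp: is_pdf_def emeasure_density)

lemma prob_space_source_law: "prob_space source_law"
  unfolding source_law_def
  by (intro prob_space_pair prob_space_density_pdf pdf1 pdf2)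

lemma prob_space_step_law: "prob_space step_law"
  unfolding step_law_def
  by (intro prob_space_pair prob_space_source_law measure_pmf.prob_space_axioms)

text \<open>Moves the problem from the abstract probability space to a finite power of one fixed
  law, where conditioning on the first steps is iterated integration.\<close>

lemma path_law:
  assumes t: "t \<in> {1..T}"
  shows "distr M (PiM {1..t} (\<lambda>_. (borel \<Otimes>\<^sub>M borel) \<Otimes>\<^sub>M count_space UNIV))
      (\<lambda>\<omega>. \<lambda>s\<in>{1..t}. ((X1 s \<omega>, X2 s \<omega>), Z s \<omega>)) = PiM {1..t} (\<lambda>_. step_law)"
proof -
  let ?I = "{1..T}"
  let ?S = "\<lambda>s \<omega>. (X1 s \<omega>, X2 s \<omega>)"
  have I: "finite ?I" "?I \<noteq> {}" using t by auto
  have S: "indep_vars (\<lambda>_. borel \<Otimes>\<^sub>M borel) ?S ?I"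
    by (rule indep_vars_Pair[OF I X1_indep X2_indep X1_X2_indep])
  \<comment> \<open>Turns the pair of trajectories into the trajectory of pairs, the form in which
    the sources are joined with \<open>Z\<close>.\<close>
  have "indep_rv (PiM ?I (\<lambda>_. borel \<Otimes>\<^sub>M borel))
      (\<lambda>\<omega>. (\<lambda>p. \<lambda>s\<in>?I. (fst p s, snd p s)) (\<lambda>s\<in>?I. X1 s \<omega>, \<lambda>s\<in>?I. X2 s \<omega>))
      (PiM ?I (\<lambda>_. count_space UNIV)) (\<lambda>\<omega>. (\<lambda>z. z) (\<lambda>s\<in>?I. Z s \<omega>))"
    by (rule indep_rv_compose[OF sources_Z_indep]) measurable
  then have SZ: "indep_rv (PiM ?I (\<lambda>_. borel \<Otimes>\<^sub>M borel)) (\<lambda>\<omega>. \<lambda>s\<in>?I. ?S s \<omega>)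
      (PiM ?I (\<lambda>_. count_space UNIV)) (\<lambda>\<omega>. \<lambda>s\<in>?I. Z s \<omega>)"
    by (simp cong: restrict_cong)
  have "indep_vars (\<lambda>_. (borel \<Otimes>\<^sub>M borel) \<Otimes>\<^sub>M count_space UNIV) (\<lambda>s \<omega>. (?S s \<omega>, Z s \<omega>)) ?I"
    by (rule indep_vars_Pair[OF I S Z_indep SZ])
  then have ind: "indep_vars (\<lambda>_. (borel \<Otimes>\<^sub>M borel) \<Otimes>\<^sub>M count_space UNIV) (\<lambda>s \<omega>. (?S s \<omega>, Z s \<omega>)) {1..t}"
    by (rule indep_vars_subset) (use t in auto)
  have law: "distr M ((borel \<Otimes>\<^sub>M borel) \<Otimes>\<^sub>M count_space UNIV) (\<lambda>\<omega>. (?S s \<omega>, Z s \<omega>)) = step_law"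
    if "s \<in> {1..t}" for s
  proof -
    have s: "s \<in> ?I" using that t by auto
    note comp = measurable_component_singleton[OF s]
    have "indep_rv borel (X1 s) borel (X2 s)"
      using indep_rv_compose[OF X1_X2_indep comp comp] s by simp
    from indep_rv_distr_Pair[OF this]
    have "distr M (borel \<Otimes>\<^sub>M borel) (?S s) = distr M borel (X1 s) \<Otimes>\<^sub>M distr M borel (X2 s)" .
    moreover have "distr M borel (X1 s) = distr M lborel (X1 s)" "distr M borel (X2 s) = distr M lborel (X2 s)"
      by (auto intro: distr_cong)
    ultimately have src: "distr M (borel \<Otimes>\<^sub>M borel) (?S s) = source_law"
      using distributed_distr_eq_density[OF X1_density[OF s]] distributed_distr_eq_density[OF X2_density[OF s]]
      by (simp add: source_law_def)
    have "indep_rv (borel \<Otimes>\<^sub>M borel) (?S s) (count_space UNIV) (Z s)"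
      using indep_rv_compose[OF SZ comp comp] s by simp
    from indep_rv_distr_Pair[OF this] show ?thesis
      by (simp add: src step_law_def Z_distr[OF s])
  qed
  have rv: "(\<lambda>\<omega>. (?S s \<omega>, Z s \<omega>)) \<in> measurable M ((borel \<Otimes>\<^sub>M borel) \<Otimes>\<^sub>M count_space UNIV)" if "s \<in> {1..t}" for s
    using ind that by (auto simp: indep_vars_def)
  have "{1..t} \<noteq> {}" using t by auto
  from indep_vars_iff_distr_eq_PiM'[OF this rv] ind
  have "distr M (PiM {1..t} (\<lambda>_. (borel \<Otimes>\<^sub>M borel) \<Otimes>\<^sub>M count_space UNIV))
      (\<lambda>\<omega>. \<lambda>s\<in>{1..t}. (?S s \<omega>, Z s \<omega>)) =
    PiM {1..t} (\<lambda>s. distr M ((borel \<Otimes>\<^sub>M borel) \<Otimes>\<^sub>M count_space UNIV) (\<lambda>\<omega>. (?S s \<omega>, Z s \<omega>)))"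
    by simp
  also have "\<dots> = PiM {1..t} (\<lambda>_. step_law)"
    by (intro PiM_cong law) auto
  finally show ?thesis .
qed

end

subsection \<open>Symmetric unimodal densities\<close>

lemma distr_lborel_reflect:
  fixes v :: "'a::euclidean_space"
  shows "distr lborel borel (\<lambda>x. v - x) = lborel"
  using lborel_affine[of "-1" v] by (simp add: density_1)

lemma rearrangement_ennreal:
  fixes a b p q :: ennreal
  assumes "a \<le> b" "q \<le> p"
  shows "a * p + b * q \<le> b * p + a * q"
proof -
  \<comment> \<open>A sum instead of the difference \<open>p - q\<close>, which is truncated and
    badly behaved at infinity in \<open>ennreal\<close>.\<close>
  obtain r where p: "p = q + r" using assms(2) by (auto simp: le_iff_add)
  have "a * p + b * q = (a * q + b * q) + a * r"
    by (simp add: p algebra_simps)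
  also have "\<dots> \<le> (a * q + b * q) + b * r"
    by (intro add_left_mono mult_right_mono assms) simp
  also have "\<dots> = b * p + a * q" by (simp add: p algebra_simps)
  finally show ?thesis .
qed

text \<open>The point reflection exchanging \<open>a\<close> and \<open>b\<close> preserves Lebesgue measure, so after averaging
  over it the claim becomes a pointwise rearrangement inequality.\<close>

lemma symmetric_unimodal_nn_integral_le:
  fixes a b :: "'a::euclidean_space" and F :: "real \<Rightarrow> ennreal"
  assumes pdf: "is_pdf p" and su: "symmetric_unimodal p a"
    and mono: "\<And>u v. 0 \<le> u \<Longrightarrow> u \<le> v \<Longrightarrow> F u \<le> F v"
    and [measurable]: "F \<in> borel_measurable borel"
  shows "(\<integral>\<^sup>+x. F (norm (x - a)) \<partial>density lborel (\<lambda>x. ennreal (p x)))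
    \<le> (\<integral>\<^sup>+x. F (norm (x - b)) \<partial>density lborel (\<lambda>x. ennreal (p x)))"
proof -
  have [measurable]: "p \<in> borel_measurable borel" using pdf by (simp add: is_pdf_def)
  let ?r = "\<lambda>x. (a + b) - x"
  have refl: "norm (?r x - b) = norm (x - a)" "norm (?r x - a) = norm (x - b)" for x
    by (simp_all add: norm_minus_commute algebra_simps)
  have double: "(\<integral>\<^sup>+x. p x * F (norm (x - d)) \<partial>lborel) + (\<integral>\<^sup>+x. p x * F (norm (x - d)) \<partial>lborel) =
      (\<integral>\<^sup>+x. F (norm (x - d)) * p x + F (norm (?r x - d)) * p (?r x) \<partial>lborel)" for d
  proof -
    have "(\<integral>\<^sup>+x. F (norm (x - d)) * p x \<partial>lborel) =
        (\<integral>\<^sup>+x. F (norm (x - d)) * p x \<partial>distr lborel borel ?r)"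
      by (simp only: distr_lborel_reflect)
    also have "\<dots> = (\<integral>\<^sup>+x. F (norm (?r x - d)) * p (?r x) \<partial>lborel)"
      by (rule nn_integral_distr) measurable
    finally show ?thesis
      by (subst nn_integral_add) (auto simp: mult.commute)
  qed
  \<comment> \<open>Of \<open>x\<close> and its reflection, the point nearer to \<open>a\<close> has
    the larger density. The left side pairs this larger density with the smaller value of
    \<open>F\<close>, the right side pairs it with the larger one.\<close>
  have "F (norm (x - a)) * p x + F (norm (?r x - a)) * p (?r x)
      \<le> F (norm (x - b)) * p x + F (norm (?r x - b)) * p (?r x)" for x
  proof (cases "norm (x - a) \<le> norm (x - b)")
    case True
    then have "p (?r x) \<le> p x"
      using su refl by (auto simp: symmetric_unimodal_def)
    with True show ?thesis
      unfolding refl by (intro rearrangement_ennreal mono ennreal_leI) auto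
  next
    case False
    then have "p x \<le> p (?r x)"
      using su refl(2) by (auto simp: symmetric_unimodal_def)
    with False show ?thesis
      unfolding refl by (subst (1 2) add.commute, intro rearrangement_ennreal mono ennreal_leI) auto
  qed
  then have "(\<integral>\<^sup>+x. p x * F (norm (x - a)) \<partial>lborel) + (\<integral>\<^sup>+x. p x * F (norm (x - a)) \<partial>lborel)
      \<le> (\<integral>\<^sup>+x. p x * F (norm (x - b)) \<partial>lborel) + (\<integral>\<^sup>+x. p x * F (norm (x - b)) \<partial>lborel)"
    unfolding double by (intro nn_integral_mono)
  \<comment> \<open>The doubling is undone by cancelling the factor 2, which is legitimate even if
    the integrals are infinite.\<close>
  then have "2 * (\<integral>\<^sup>+x. p x * F (norm (x - a)) \<partial>lborel) \<le> 2 * (\<integral>\<^sup>+x. p x * F (norm (x - b)) \<partial>lborel)"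
    by (simp add: mult_2)
  then have "(\<integral>\<^sup>+x. p x * F (norm (x - a)) \<partial>lborel) \<le> (\<integral>\<^sup>+x. p x * F (norm (x - b)) \<partial>lborel)"
    by (subst (asm) ennreal_mult_le_mult_iff) auto
  then show ?thesis
    by (simp add: nn_integral_density)
qed

context energy_harvesting_model
begin

lemma nn_integral_source_law:
  assumes "h \<in> borel_measurable (borel \<Otimes>\<^sub>M borel)"
  shows "(\<integral>\<^sup>+x. h x \<partial>source_law) =
      (\<integral>\<^sup>+x1. \<integral>\<^sup>+x2. h (x1, x2) \<partial>density lborel (\<lambda>x. ennreal (\<pi>2 x)) \<partial>density lborel (\<lambda>x. ennreal (\<pi>1 x)))"
    and "(\<integral>\<^sup>+x. h x \<partial>source_law) =
      (\<integral>\<^sup>+x2. \<integral>\<^sup>+x1. h (x1, x2) \<partial>density lborel (\<lambda>x. ennreal (\<pi>1 x)) \<partial>density lborel (\<lambda>x. ennreal (\<pi>2 x)))"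
proof -
  interpret D1: prob_space "density lborel (\<lambda>x. ennreal (\<pi>1 x))" by (rule prob_space_density_pdf[OF pdf1])
  interpret D2: prob_space "density lborel (\<lambda>x. ennreal (\<pi>2 x))" by (rule prob_space_density_pdf[OF pdf2])
  interpret P: pair_sigma_finite "density lborel (\<lambda>x. ennreal (\<pi>1 x))" "density lborel (\<lambda>x. ennreal (\<pi>2 x))" ..
  have [measurable]: "h \<in> borel_measurable (density lborel (\<lambda>x. ennreal (\<pi>1 x)) \<Otimes>\<^sub>M density lborel (\<lambda>x. ennreal (\<pi>2 x)))"
    using assms by (simp cong: measurable_cong_sets sets_pair_measure_cong)
  show "(\<integral>\<^sup>+x. h x \<partial>source_law) =
      (\<integral>\<^sup>+x1. \<integral>\<^sup>+x2. h (x1, x2) \<partial>density lborel (\<lambda>x. ennreal (\<pi>2 x)) \<partial>density lborel (\<lambda>x. ennreal (\<pi>1 x)))"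
    unfolding source_law_def by (subst D2.nn_integral_fst[symmetric]) auto
  show "(\<integral>\<^sup>+x. h x \<partial>source_law) =
      (\<integral>\<^sup>+x2. \<integral>\<^sup>+x1. h (x1, x2) \<partial>density lborel (\<lambda>x. ennreal (\<pi>1 x)) \<partial>density lborel (\<lambda>x. ennreal (\<pi>2 x)))"
    unfolding source_law_def by (subst P.nn_integral_snd[symmetric]) auto
qed

text \<open>One centre is moved at a time. With the other coordinate frozen in the outer integral,
  the inner integrand is a monotone function of a single distance; exchanging the order of
  integration then gives the other coordinate its turn.\<close>

lemma source_law_nn_integral_le:
  assumes su: "symmetric_unimodal \<pi>1 a1" "symmetric_unimodal \<pi>2 a2"
    and mono: "\<And>u v u' v'. 0 \<le> u \<Longrightarrow> u \<le> u' \<Longrightarrow> 0 \<le> v \<Longrightarrow> v \<le> v' \<Longrightarrow> G u v \<le> G u' v'"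
    and [measurable]: "case_prod G \<in> borel_measurable (borel \<Otimes>\<^sub>M borel)"
  shows "(\<integral>\<^sup>+x. G (norm (fst x - a1)) (norm (snd x - a2)) \<partial>source_law) \<le>
      (\<integral>\<^sup>+x. G (norm (fst x - b1)) (norm (snd x - b2)) \<partial>source_law)"
proof -
  let ?D1 = "density lborel (\<lambda>x. ennreal (\<pi>1 x))" and ?D2 = "density lborel (\<lambda>x. ennreal (\<pi>2 x))"
  have G[measurable]: "(\<lambda>x. G (f x) (g x)) \<in> borel_measurable N"
    if "f \<in> borel_measurable N" "g \<in> borel_measurable N" for f g and N :: "'z measure"
    using measurable_compose[OF measurable_Pair[OF that], of "case_prod G"] by simp
  have "(\<integral>\<^sup>+x. G (norm (fst x - a1)) (norm (snd x - a2)) \<partial>source_law) =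
      (\<integral>\<^sup>+x1. \<integral>\<^sup>+x2. G (norm (x1 - a1)) (norm (x2 - a2)) \<partial>?D2 \<partial>?D1)"
    by (subst nn_integral_source_law(1)) auto
  also have "\<dots> \<le> (\<integral>\<^sup>+x1. \<integral>\<^sup>+x2. G (norm (x1 - a1)) (norm (x2 - b2)) \<partial>?D2 \<partial>?D1)"
    by (intro nn_integral_mono symmetric_unimodal_nn_integral_le pdf2 su mono) auto
  also have "\<dots> = (\<integral>\<^sup>+x. G (norm (fst x - a1)) (norm (snd x - b2)) \<partial>source_law)"
    by (subst nn_integral_source_law(1)) auto
  also have "\<dots> = (\<integral>\<^sup>+x2. \<integral>\<^sup>+x1. G (norm (x1 - a1)) (norm (x2 - b2)) \<partial>?D1 \<partial>?D2)"
    by (subst nn_integral_source_law(2)) auto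
  also have "\<dots> \<le> (\<integral>\<^sup>+x2. \<integral>\<^sup>+x1. G (norm (x1 - b1)) (norm (x2 - b2)) \<partial>?D1 \<partial>?D2)"
    by (intro nn_integral_mono symmetric_unimodal_nn_integral_le pdf1 su mono) auto
  also have "\<dots> = (\<integral>\<^sup>+x. G (norm (fst x - b1)) (norm (snd x - b2)) \<partial>source_law)"
    by (subst nn_integral_source_law(2)) auto
  finally show ?thesis .
qed

end

subsection \<open>Sample paths and stage costs\<close>

lemma measurable_observe [measurable (raw)]:
  fixes g :: "'z \<Rightarrow> 'a::euclidean_space"
  assumes [measurable]: "u \<in> measurable N (count_space UNIV)" "g \<in> borel_measurable N"
  shows "(\<lambda>w. observe i (u w) (g w)) \<in> measurable N obs_borel"
proof -
  have [measurable]: "(Some :: 'a \<Rightarrow> 'a option) \<in> measurable borel obs_borel"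
    by (rule measurableI) (auto simp: sets_obs_borel space_obs_borel)
  have [measurable]: "(\<lambda>_. None :: 'a option) \<in> measurable N obs_borel"
    by (rule measurable_const) (simp add: space_obs_borel)
  show ?thesis
    unfolding observe_def by measurable
qed

text \<open>Causality: neither quantity at time \<open>t\<close> reads the energy harvested at
  \<open>t\<close>, and the battery level does not read the source at \<open>t\<close> either. Hence
  a path of \<open>n\<close> steps may be extended arbitrarily without changing the level at
  \<open>Suc n\<close>.\<close>

lemma battery_decision_cong:
  assumes "\<And>s. s \<in> {1..<t} \<Longrightarrow> x s = x' s" "\<And>s. s \<in> {1..<t} \<Longrightarrow> z s = z' s"
  shows battery_cong: "battery B f x z t = battery B f x' z' t"
    and decision_cong: "x t = x' t \<Longrightarrow> decision B f x z t = decision B f x' z' t"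
proof -
  have "battery B f x z t = battery B f x' z' t \<and>
      (x t = x' t \<longrightarrow> decision B f x z t = decision B f x' z' t)"
    using assms
  proof (induction t rule: less_induct)
    case (less t)
    have IH: "battery B f x z s = battery B f x' z' s" "decision B f x z s = decision B f x' z' s"
      if "s \<in> {1..<t}" for s
      using less.IH[of s] less.prems that by auto
    have bat: "battery B f x z t = battery B f x' z' t"
    proof (cases "t \<le> 1")
      case True
      then show ?thesis by (cases t) auto
    next
      case False
      then obtain n where t: "t = Suc (Suc n)" by (auto simp: not_le elim!: less_natE)
      have "Suc n \<in> {1..<t}" using t by simp
      then show ?thesis using IH less.prems(2) by (simp add: t)
    qed
    have "decision B f x z t = decision B f x' z' t" if "x t = x' t"
    proof -
      have le: "s \<in> {1..<t} \<or> s = t" if "s \<in> {1..t}" for s using that by auto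
      have lt: "s \<in> {1..<t}" if "s \<in> {1..t - 1}" for s using that by auto
      have "restrict x {1..t} = restrict x' {1..t}"
        using le less.prems(1) \<open>x t = x' t\<close> by (intro restrict_ext) metis
      moreover have "restrict (battery B f x z) {1..t} = restrict (battery B f x' z') {1..t}"
        using le IH(1) bat by (intro restrict_ext) metis
      moreover have "(\<lambda>s\<in>{1..t - 1}. (observe 1 (decision B f x z s) (fst (x s)),
            observe 2 (decision B f x z s) (snd (x s)))) =
          (\<lambda>s\<in>{1..t - 1}. (observe 1 (decision B f x' z' s) (fst (x' s)),
            observe 2 (decision B f x' z' s) (snd (x' s))))"
        by (intro restrict_ext) (simp only: IH(2)[OF lt] less.prems(1)[OF lt])
      ultimately show ?thesis
        by (simp only: decision.simps[of B f x z t] decision.simps[of B f x' z' t])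
    qed
    with bat show ?case by blast
  qed
  then show "battery B f x z t = battery B f x' z' t"
    "x t = x' t \<Longrightarrow> decision B f x z t = decision B f x' z' t" by auto
qed

section \<open>Schedulers that are feasible on every path\<close>

definition measurable_scheduler :: "nat \<Rightarrow> ('a::euclidean_space, 'b::euclidean_space) scheduler \<Rightarrow> bool" where
  "measurable_scheduler T f \<longleftrightarrow> (\<forall>t\<in>{1..T}.
     f t \<in> measurable (PiM {1..t} (\<lambda>_. borel \<Otimes>\<^sub>M borel) \<Otimes>\<^sub>M PiM {1..t} (\<lambda>_. count_space UNIV)
                            \<Otimes>\<^sub>M PiM {1..t - 1} (\<lambda>_. obs_borel \<Otimes>\<^sub>M obs_borel))
                         (count_space UNIV))"

definition feasible_scheduler :: "nat \<Rightarrow> ('a, 'b) scheduler \<Rightarrow> bool" where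
  "feasible_scheduler B f \<longleftrightarrow> (\<forall>x z t. 1 \<le> t \<longrightarrow> decision B f x z t \<in> decisions (battery B f x z t))"

text \<open>Admissibility constrains decisions only along the sample paths of the model, while the
  induction on the product space needs feasibility on every path.\<close>

definition clip_scheduler :: "('a, 'b) scheduler \<Rightarrow> ('a, 'b) scheduler" where
  "clip_scheduler f t = (\<lambda>(x, e, y). if f t (x, e, y) \<in> decisions (e t) then f t (x, e, y) else 0)"

lemma feasible_clip_scheduler: "feasible_scheduler B (clip_scheduler f)"
  unfolding feasible_scheduler_def
proof (intro allI impI)
  fix x :: "nat \<Rightarrow> 'a \<times> 'b" and z and t :: nat assume "1 \<le> t"
  then show "decision B (clip_scheduler f) x z t \<in> decisions (battery B (clip_scheduler f) x z t)"
    by (subst decision.simps) (auto simp: clip_scheduler_def decisions_def)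
qed

lemma measurable_decisions_pred [measurable (raw)]:
  assumes [measurable]: "u \<in> measurable N (count_space UNIV)" "e \<in> measurable N (count_space UNIV)"
  shows "Measurable.pred N (\<lambda>w. u w \<in> decisions (e w))"
  unfolding decisions_def by measurable

lemma measurable_clip_scheduler:
  assumes "measurable_scheduler T f"
  shows "measurable_scheduler T (clip_scheduler f)"
  unfolding measurable_scheduler_def
proof
  fix t assume t: "t \<in> {1..T}"
  then have [measurable]: "f t \<in> measurable (PiM {1..t} (\<lambda>_. borel \<Otimes>\<^sub>M borel) \<Otimes>\<^sub>M
      PiM {1..t} (\<lambda>_. count_space UNIV) \<Otimes>\<^sub>M PiM {1..t - 1} (\<lambda>_. obs_borel \<Otimes>\<^sub>M obs_borel)) (count_space UNIV)"
    and tt: "t \<in> {1..t}"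
    using assms t by (auto simp: measurable_scheduler_def)
  have [measurable]: "(\<lambda>e. e t) \<in> measurable (PiM {1..t} (\<lambda>_. count_space UNIV)) (count_space (UNIV :: nat set))"
    by (rule measurable_component_singleton[OF tt])
  show "clip_scheduler f t \<in> measurable (PiM {1..t} (\<lambda>_. borel \<Otimes>\<^sub>M borel) \<Otimes>\<^sub>M
      PiM {1..t} (\<lambda>_. count_space UNIV) \<Otimes>\<^sub>M PiM {1..t - 1} (\<lambda>_. obs_borel \<Otimes>\<^sub>M obs_borel)) (count_space UNIV)"
    unfolding clip_scheduler_def by measurable
qed

text \<open>As long as no decision has been altered, the levels and observations passed to
  \<open>f\<close> are the original ones, so the next feasible decision survives the test as well.
  The argument concerns a single path, so feasibility along that path suffices.\<close>

lemma clip_scheduler_eq: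
  assumes "\<And>s. s \<in> {1..T} \<Longrightarrow> decision B f x z s \<in> decisions (battery B f x z s)"
    and "1 \<le> t" "t \<le> T"
  shows "decision B (clip_scheduler f) x z t = decision B f x z t"
proof -
  have "battery B (clip_scheduler f) x z t = battery B f x z t \<and>
      decision B (clip_scheduler f) x z t = decision B f x z t"
    using assms(2,3)
  proof (induction t rule: less_induct)
    case (less t)
    have IH: "battery B (clip_scheduler f) x z s = battery B f x z s"
      "decision B (clip_scheduler f) x z s = decision B f x z s" if "s \<in> {1..<t}" for s
      using less.IH[of s] less.prems that by auto
    have bat: "battery B (clip_scheduler f) x z t = battery B f x z t"
    proof (cases "t = 1")
      case False
      then obtain n where t: "t = Suc (Suc n)" using less.prems by (cases t; cases "t - 1") auto
      have "Suc n \<in> {1..<t}" using t by simp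
      then show ?thesis using IH by (simp add: t)
    qed simp
    have le: "s \<in> {1..<t} \<or> s = t" if "s \<in> {1..t}" for s using that by auto
    have lt: "s \<in> {1..<t}" if "s \<in> {1..t - 1}" for s using that by auto
    have "restrict (battery B (clip_scheduler f) x z) {1..t} = restrict (battery B f x z) {1..t}"
      using le IH(1) bat by (intro restrict_ext) metis
    moreover have "(\<lambda>s\<in>{1..t - 1}. (observe 1 (decision B (clip_scheduler f) x z s) (fst (x s)),
            observe 2 (decision B (clip_scheduler f) x z s) (snd (x s)))) =
          (\<lambda>s\<in>{1..t - 1}. (observe 1 (decision B f x z s) (fst (x s)),
            observe 2 (decision B f x z s) (snd (x s))))"
      by (intro restrict_ext) (simp only: IH(2)[OF lt])
    ultimately have "decision B (clip_scheduler f) x z t =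
        (if decision B f x z t \<in> decisions (battery B f x z t) then decision B f x z t else 0)"
      using less.prems
      by (subst decision.simps, subst (1 2) decision.simps[of B f x z t]) (simp add: clip_scheduler_def)
    then show ?case using bat assms(1)[of t] less.prems by simp
  qed
  then show ?thesis by simp
qed

section \<open>Measurability along a path and stage costs\<close>

abbreviation path_battery where
  "path_battery B f w t \<equiv> battery B f (\<lambda>s. fst (w s)) (\<lambda>s. snd (w s)) t"

abbreviation path_decision where
  "path_decision B f w t \<equiv> decision B f (\<lambda>s. fst (w s)) (\<lambda>s. snd (w s)) t"

abbreviation path_space where
  "path_space n \<equiv> PiM {1..n::nat} (\<lambda>_. (borel \<Otimes>\<^sub>M borel) \<Otimes>\<^sub>M count_space (UNIV :: nat set))"

lemma measurable_path_source:
  assumes "s \<in> {1..n}"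
  shows "(\<lambda>w. fst (w s)) \<in> measurable (path_space n) ((borel :: 'a::euclidean_space measure) \<Otimes>\<^sub>M (borel :: 'b::euclidean_space measure))"
    and "(\<lambda>w :: nat \<Rightarrow> ('a \<times> 'b) \<times> nat. fst (fst (w s))) \<in> borel_measurable (path_space n)"
    and "(\<lambda>w :: nat \<Rightarrow> ('a \<times> 'b) \<times> nat. snd (fst (w s))) \<in> borel_measurable (path_space n)"
proof -
  have [measurable]: "(\<lambda>w. w s) \<in> measurable (path_space n) (((borel :: 'a measure) \<Otimes>\<^sub>M (borel :: 'b measure)) \<Otimes>\<^sub>M count_space UNIV)"
    by (rule measurable_component_singleton[OF assms])
  show "(\<lambda>w. fst (w s)) \<in> measurable (path_space n) ((borel :: 'a measure) \<Otimes>\<^sub>M (borel :: 'b measure))"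
    "(\<lambda>w :: nat \<Rightarrow> ('a \<times> 'b) \<times> nat. fst (fst (w s))) \<in> borel_measurable (path_space n)"
    "(\<lambda>w :: nat \<Rightarrow> ('a \<times> 'b) \<times> nat. snd (fst (w s))) \<in> borel_measurable (path_space n)"
    by measurable
qed

text \<open>The induction has to be simultaneous: a level depends on the preceding decision, a
  decision on all levels up to its own time. Levels are covered one time further than decisions
  because the level at \<open>Suc n\<close> is settled by the first \<open>n\<close> steps.\<close>

lemma path_measurable:
  fixes f :: "('a::euclidean_space, 'b::euclidean_space) scheduler"
  assumes f: "measurable_scheduler T f" and n: "n \<le> T"
  shows measurable_path_battery: "t \<le> Suc n \<Longrightarrow>
      (\<lambda>w. path_battery B f w t) \<in> measurable (path_space n) (count_space UNIV)"
    and measurable_path_decision: "1 \<le> t \<Longrightarrow> t \<le> n \<Longrightarrow>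
      (\<lambda>w. path_decision B f w t) \<in> measurable (path_space n) (count_space UNIV)"
proof -
  have "(t \<le> Suc n \<longrightarrow> (\<lambda>w. path_battery B f w t) \<in> measurable (path_space n) (count_space UNIV)) \<and>
    (1 \<le> t \<longrightarrow> t \<le> n \<longrightarrow> (\<lambda>w. path_decision B f w t) \<in> measurable (path_space n) (count_space UNIV))"
  proof (induction t rule: less_induct)
    case (less t)
    have bat: "(\<lambda>w. path_battery B f w t) \<in> measurable (path_space n) (count_space UNIV)" if "t \<le> Suc n"
    proof (cases "t \<le> 1")
      case True
      then show ?thesis by (cases t) auto
    next
      case False
      then obtain m where t: "t = Suc (Suc m)" by (auto simp: not_le elim!: less_natE)
      have m: "Suc m \<in> {1..n}" using that t by auto
      have [measurable]: "(\<lambda>w. path_battery B f w (Suc m)) \<in> measurable (path_space n) (count_space UNIV)"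
        "(\<lambda>w. path_decision B f w (Suc m)) \<in> measurable (path_space n) (count_space UNIV)"
        using less.IH[of "Suc m"] m t by auto
      have [measurable]: "(\<lambda>w. w (Suc m)) \<in> measurable (path_space n) ((borel \<Otimes>\<^sub>M borel) \<Otimes>\<^sub>M count_space UNIV)"
        by (rule measurable_component_singleton[OF m])
      show ?thesis unfolding t by (subst battery.simps(3)) measurable
    qed
    have "(\<lambda>w. path_decision B f w t) \<in> measurable (path_space n) (count_space UNIV)" if t: "1 \<le> t" "t \<le> n"
    proof -
      have ft: "f t \<in> measurable (PiM {1..t} (\<lambda>_. borel \<Otimes>\<^sub>M borel) \<Otimes>\<^sub>M
          PiM {1..t} (\<lambda>_. count_space UNIV) \<Otimes>\<^sub>M PiM {1..t - 1} (\<lambda>_. obs_borel \<Otimes>\<^sub>M obs_borel)) (count_space UNIV)"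
        using f t n by (auto simp: measurable_scheduler_def)
      have bat': "(\<lambda>w. path_battery B f w s) \<in> measurable (path_space n) (count_space UNIV)"
        if "s \<in> {1..t}" for s
        using less.IH[of s] bat t that by (cases "s = t") auto
      have dec: "(\<lambda>w. path_decision B f w s) \<in> measurable (path_space n) (count_space UNIV)"
        if "s \<in> {1..t - 1}" for s
        using less.IH[of s] t that by auto
      have src: "(\<lambda>w. fst (w s)) \<in> measurable (path_space n) ((borel :: 'a measure) \<Otimes>\<^sub>M (borel :: 'b measure))"
        if "s \<in> {1..t}" for s
        using t that by (intro measurable_path_source) auto
      have lt: "s \<in> {1..n}" if "s \<in> {1..t - 1}" for s
        using that t by auto
      show ?thesis
        by (subst decision.simps, intro measurable_compose[OF _ ft] measurable_Pair measurable_restrict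
            measurable_observe src measurable_path_source(2,3)[OF lt] bat' dec)
    qed
    with bat show ?case by blast
  qed
  then show "t \<le> Suc n \<Longrightarrow>
      (\<lambda>w. path_battery B f w t) \<in> measurable (path_space n) (count_space UNIV)"
    "1 \<le> t \<Longrightarrow> t \<le> n \<Longrightarrow>
      (\<lambda>w. path_decision B f w t) \<in> measurable (path_space n) (count_space UNIV)" by auto
qed

definition stage_cost ::
  "nat \<Rightarrow> real \<Rightarrow> ('a::euclidean_space, 'b::euclidean_space) scheduler \<Rightarrow> 'a estimator \<Rightarrow> 'b estimator
    \<Rightarrow> nat \<Rightarrow> (nat \<Rightarrow> ('a \<times> 'b) \<times> nat) \<Rightarrow> ennreal" where
  "stage_cost B c f g1 g2 t w = ennreal
     ((norm (fst (fst (w t)) - g1 t (\<lambda>s\<in>{1..t}. observe 1 (path_decision B f w s) (fst (fst (w s))))))\<^sup>2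
      + (norm (snd (fst (w t)) - g2 t (\<lambda>s\<in>{1..t}. observe 2 (path_decision B f w s) (snd (fst (w s))))))\<^sup>2
      + c * (if path_decision B f w t \<noteq> 0 then 1 else 0))"

text \<open>The energy harvested at \<open>t\<close> enters only the level at \<open>t + 1\<close>.
  This permits cutting a path off after \<open>t\<close> and putting a dummy energy at
  \<open>t\<close>.\<close>

lemma stage_cost_cong:
  assumes "1 \<le> t" and x: "\<And>s. s \<in> {1..t} \<Longrightarrow> fst (w s) = fst (w' s)"
    and z: "\<And>s. s \<in> {1..<t} \<Longrightarrow> snd (w s) = snd (w' s)"
  shows "stage_cost B c f g1 g2 t w = stage_cost B c f g1 g2 t w'"
proof -
  have d: "path_decision B f w s = path_decision B f w' s" if "s \<in> {1..t}" for s
    using that x z by (intro decision_cong) auto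
  have "(\<lambda>s\<in>{1..t}. observe 1 (path_decision B f w s) (fst (fst (w s)))) =
      (\<lambda>s\<in>{1..t}. observe 1 (path_decision B f w' s) (fst (fst (w' s))))"
    "(\<lambda>s\<in>{1..t}. observe 2 (path_decision B f w s) (snd (fst (w s)))) =
      (\<lambda>s\<in>{1..t}. observe 2 (path_decision B f w' s) (snd (fst (w' s))))"
    by (intro restrict_ext; simp only: d x)+
  moreover have "t \<in> {1..t}" using \<open>1 \<le> t\<close> by simp
  ultimately show ?thesis
    unfolding stage_cost_def by (simp only: d x)
qed

lemma measurable_stage_cost:
  assumes f: "measurable_scheduler T f" and t: "1 \<le> t" "t \<le> T"
    and g: "admissible_estimator T g1" "admissible_estimator T g2"
  shows "stage_cost B c f g1 g2 t \<in> borel_measurable (path_space t)"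
proof -
  have [measurable]: "g1 t \<in> measurable (PiM {1..t} (\<lambda>_. obs_borel)) borel"
    "g2 t \<in> measurable (PiM {1..t} (\<lambda>_. obs_borel)) borel"
    using g t by (auto simp: admissible_estimator_def)
  have dec: "(\<lambda>w. path_decision B f w s) \<in> measurable (path_space t) (count_space UNIV)"
    if "s \<in> {1..t}" for s
    using that t by (intro measurable_path_decision[OF f]) auto
  have [measurable]: "(\<lambda>w. path_decision B f w t) \<in> measurable (path_space t) (count_space UNIV)"
    using t by (intro dec) simp
  have [measurable]: "(\<lambda>w. \<lambda>s\<in>{1..t}. observe 1 (path_decision B f w s) (fst (fst (w s)))) \<in>
      measurable (path_space t) (PiM {1..t} (\<lambda>_. obs_borel))"
    "(\<lambda>w. \<lambda>s\<in>{1..t}. observe 2 (path_decision B f w s) (snd (fst (w s)))) \<in>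
      measurable (path_space t) (PiM {1..t} (\<lambda>_. obs_borel))"
    by (intro measurable_restrict measurable_observe dec measurable_path_source; assumption)+
  have "t \<in> {1..t}" using t by simp
  note [measurable] = measurable_path_source[OF this]
  show ?thesis
    unfolding stage_cost_def by measurable
qed

lemma admissible_default_estimator: "admissible_estimator T (default_estimator a)"
proof -
  have [measurable]: "(\<lambda>y. case y of Some x \<Rightarrow> x | None \<Rightarrow> a) \<in> measurable obs_borel borel"
    by (rule measurableI) (auto simp: sets_obs_borel space_obs_borel vimage_def)
  show ?thesis
    unfolding admissible_estimator_def default_estimator_def
  proof
    fix t assume "t \<in> {1..T}"
    then have "(\<lambda>y. y t) \<in> measurable (PiM {1..t} (\<lambda>_. obs_borel)) obs_borel"
      by (intro measurable_component_singleton) auto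
    then show "(\<lambda>y. case y t of Some x \<Rightarrow> x | None \<Rightarrow> a) \<in> measurable (PiM {1..t} (\<lambda>_. obs_borel)) borel"
      by measurable
  qed
qed

section \<open>Threshold rules and the comparison of decisions in one stage\<close>

lemma first_argmax_pair: "first_argmax {1, 2} h = (if h 2 \<le> h 1 then 1 else 2)"
  unfolding first_argmax_def by (rule Least_equality) (auto split: if_splits)

lemma threshold_rule_eq:
  "threshold_rule a1 a2 \<tau> t x e =
     (if e = 0 then 0 else if max (norm (fst x - a1)) (norm (snd x - a2)) \<le> \<tau> t (int e) then 0
      else if norm (snd x - a2) \<le> norm (fst x - a1) then 1 else 2)"
  unfolding threshold_rule_def first_argmax_pair by (simp add: deviation_def)

lemma threshold_rule_in_decisions: "threshold_rule a1 a2 \<tau> t x e \<in> decisions e"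
  by (simp add: threshold_rule_eq decisions_def)

lemma decision_threshold:
  "1 \<le> t \<Longrightarrow> decision B (threshold_scheduler a1 a2 \<tau>) x z t =
    threshold_rule a1 a2 \<tau> t (x t) (battery B (threshold_scheduler a1 a2 \<tau>) x z t)"
  by (subst decision.simps) (simp add: threshold_scheduler_def)

lemma feasible_threshold_scheduler: "feasible_scheduler B (threshold_scheduler a1 a2 \<tau>)"
  by (simp add: feasible_scheduler_def decision_threshold threshold_rule_in_decisions)

lemma measurable_threshold_scheduler:
  fixes a1 :: "'a::euclidean_space" and a2 :: "'b::euclidean_space"
  shows "measurable_scheduler T (threshold_scheduler a1 a2 \<tau>)"
  unfolding measurable_scheduler_def
proof
  fix t assume "t \<in> {1..T}"
  then have tt: "t \<in> {1..t}" by simp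
  have [measurable]: "(\<lambda>e. e t) \<in> measurable (PiM {1..t} (\<lambda>_. count_space UNIV)) (count_space (UNIV :: nat set))"
    "(\<lambda>x. x t) \<in> measurable (PiM {1..t} (\<lambda>_. borel \<Otimes>\<^sub>M borel)) ((borel :: 'a measure) \<Otimes>\<^sub>M (borel :: 'b measure))"
    by (rule measurable_component_singleton[OF tt])+
  have [measurable]: "(\<lambda>(x, e). threshold_rule a1 a2 \<tau> t x e) \<in>
      measurable ((borel \<Otimes>\<^sub>M borel) \<Otimes>\<^sub>M count_space UNIV) (count_space UNIV)"
    unfolding threshold_rule_eq by measurable
  have "(\<lambda>p. (\<lambda>(x, e). threshold_rule a1 a2 \<tau> t x e) (fst p t, fst (snd p) t)) \<in>
      measurable (PiM {1..t} (\<lambda>_. borel \<Otimes>\<^sub>M borel) \<Otimes>\<^sub>M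
      PiM {1..t} (\<lambda>_. count_space UNIV) \<Otimes>\<^sub>M PiM {1..t - 1} (\<lambda>_. obs_borel \<Otimes>\<^sub>M obs_borel)) (count_space UNIV)"
    by measurable
  then show "threshold_scheduler a1 a2 \<tau> t \<in> measurable (PiM {1..t} (\<lambda>_. borel \<Otimes>\<^sub>M borel) \<Otimes>\<^sub>M
      PiM {1..t} (\<lambda>_. count_space UNIV) \<Otimes>\<^sub>M PiM {1..t - 1} (\<lambda>_. obs_borel \<Otimes>\<^sub>M obs_borel)) (count_space UNIV)"
    by (simp add: threshold_scheduler_def split_beta')
qed

text \<open>A transmitted source is charged no estimation error. This is exact for an estimator that
  copies its packet and a lower bound for any other.\<close>

definition action_cost :: "real \<Rightarrow> ennreal \<Rightarrow> ennreal \<Rightarrow> nat \<Rightarrow> real \<Rightarrow> real \<Rightarrow> ennreal" where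
  "action_cost c C0 C1 u d1 d2 =
     (if u = 0 then ennreal (d1 + d2) + C0 else ennreal ((if u = 1 then d2 else d1) + c) + C1)"

text \<open>Closed form of the minimum of \<open>action_cost\<close> over
  \<open>decisions e\<close>, in which monotonicity in both distances is visible.\<close>

definition best_cost :: "real \<Rightarrow> ennreal \<Rightarrow> ennreal \<Rightarrow> nat \<Rightarrow> real \<Rightarrow> real \<Rightarrow> ennreal" where
  "best_cost c C0 C1 e d1 d2 =
     (if e = 0 then ennreal (d1 + d2) + C0
      else min (ennreal (d1 + d2) + C0) (ennreal (min d1 d2 + c) + C1))"

lemma best_cost_le_action_cost:
  assumes "u \<in> decisions e"
  shows "best_cost c C0 C1 e d1 d2 \<le> action_cost c C0 C1 u d1 d2"
proof (cases "u = 0")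
  case True
  then show ?thesis by (simp add: best_cost_def action_cost_def)
next
  case False
  with assms have e: "e \<noteq> 0" and u: "u = 1 \<or> u = 2" by (auto simp: decisions_def split: if_splits)
  have "best_cost c C0 C1 e d1 d2 \<le> ennreal (min d1 d2 + c) + C1"
    using e by (simp add: best_cost_def)
  also have "\<dots> \<le> action_cost c C0 C1 u d1 d2"
    using False by (auto simp: action_cost_def intro!: add_right_mono ennreal_leI)
  finally show ?thesis .
qed

lemma best_cost_mono:
  "d1 \<le> d1' \<Longrightarrow> d2 \<le> d2' \<Longrightarrow> best_cost c C0 C1 e d1 d2 \<le> best_cost c C0 C1 e d1' d2'"
  unfolding best_cost_def
  by (cases "e = 0"; simp only: if_True if_False simp_thms; intro min.mono add_mono ennreal_leI order_refl; assumption)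

text \<open>Never transmitting would need an infinite threshold; it is called for only if transmitting
  costs \<open>\<infinity>\<close> and staying idle does not, and then \<open>cost_to_go_unreachable\<close> makes any threshold optimal.\<close>

definition optimal_threshold :: "real \<Rightarrow> ennreal \<Rightarrow> ennreal \<Rightarrow> real" where
  "optimal_threshold c C0 C1 =
     (if C0 = \<infinity> \<or> c + enn2real C1 < enn2real C0 then - 1 else sqrt (c + enn2real C1 - enn2real C0))"

text \<open>Since \<open>d1 + d2 - min d1 d2 = max d1 d2\<close>, for finite costs to go idling is
  at least as good exactly if the squared larger deviation is at most \<open>c + C1 - C0\<close>.
  The rule compares norms, hence the square root. The value -1 lies below every norm and makes a
  nonempty battery always transmit.\<close>

lemma action_cost_threshold:
  assumes "0 \<le> c" and \<tau>: "\<tau> t (int e) = optimal_threshold c C0 C1"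
    and C: "e \<noteq> 0 \<Longrightarrow> C1 = \<infinity> \<Longrightarrow> C0 = \<infinity>"
  shows "action_cost c C0 C1 (threshold_rule a1 a2 \<tau> t x e) ((norm (fst x - a1))\<^sup>2) ((norm (snd x - a2))\<^sup>2)
    = best_cost c C0 C1 e ((norm (fst x - a1))\<^sup>2) ((norm (snd x - a2))\<^sup>2)"
proof -
  define n1 n2 where n: "n1 = norm (fst x - a1)" "n2 = norm (snd x - a2)"
  have n0: "0 \<le> n1" "0 \<le> n2" by (simp_all add: n)
  have min_sq: "min (n1\<^sup>2) (n2\<^sup>2) = (if n2 \<le> n1 then n2\<^sup>2 else n1\<^sup>2)"
    using n0 by (auto simp: min_def power2_le_iff_abs_le abs_le_square_iff[symmetric])
  have rule: "threshold_rule a1 a2 \<tau> t x e =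
      (if e = 0 then 0 else if max n1 n2 \<le> optimal_threshold c C0 C1 then 0 else if n2 \<le> n1 then 1 else 2)"
    by (simp add: threshold_rule_eq n \<tau>)
  show ?thesis
    unfolding n[symmetric] rule
  proof (cases "e = 0")
    case False
    show "action_cost c C0 C1 (if e = 0 then 0 else if max n1 n2 \<le> optimal_threshold c C0 C1 then 0
        else if n2 \<le> n1 then 1 else 2) (n1\<^sup>2) (n2\<^sup>2) = best_cost c C0 C1 e (n1\<^sup>2) (n2\<^sup>2)"
    proof (cases "C0 = \<infinity>")
      case True
      then show ?thesis
        using False n0 by (simp add: action_cost_def best_cost_def optimal_threshold_def min_sq)
    next
      case fin: False
      then have "C1 \<noteq> \<infinity>" using C False by auto
      with fin obtain r0 r1 where r: "C0 = ennreal r0" "C1 = ennreal r1" "0 \<le> r0" "0 \<le> r1"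
        by (cases C0; cases C1) auto
      have idle: "ennreal (n1\<^sup>2 + n2\<^sup>2) + C0 = ennreal (n1\<^sup>2 + n2\<^sup>2 + r0)"
        and send: "ennreal (min (n1\<^sup>2) (n2\<^sup>2) + c) + C1 = ennreal (min (n1\<^sup>2) (n2\<^sup>2) + c + r1)"
        using r \<open>0 \<le> c\<close> by (simp_all add: ennreal_plus[symmetric] del: ennreal_plus)
      \<comment> \<open>If \<open>c + r1 < r0\<close>, both sides are false because the left
        argument and the square are nonnegative; otherwise the threshold is a genuine square
        root.\<close>
      have "max n1 n2 \<le> optimal_threshold c C0 C1 \<longleftrightarrow> (max n1 n2)\<^sup>2 \<le> c + r1 - r0"
      proof (cases "c + r1 < r0")
        case True
        have "\<not> (max n1 n2)\<^sup>2 \<le> c + r1 - r0" using True zero_le_power2[of "max n1 n2"] by linarith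
        then show ?thesis using True n0 r by (simp add: optimal_threshold_def)
      next
        case False
        then show ?thesis
          using n0 r real_le_rsqrt[of "max n1 n2" "c + r1 - r0"] real_sqrt_ge_0_iff
          by (auto simp: optimal_threshold_def max_def intro: real_le_rsqrt sqrt_ge_absD)
      qed
      also have "\<dots> \<longleftrightarrow> n1\<^sup>2 + n2\<^sup>2 + r0 \<le> min (n1\<^sup>2) (n2\<^sup>2) + c + r1"
        unfolding min_sq by (auto simp: max_def)
      finally have iff: "max n1 n2 \<le> optimal_threshold c C0 C1 \<longleftrightarrow>
          n1\<^sup>2 + n2\<^sup>2 + r0 \<le> min (n1\<^sup>2) (n2\<^sup>2) + c + r1" .
      show ?thesis
      proof (cases "max n1 n2 \<le> optimal_threshold c C0 C1")
        case True
        then have "ennreal (n1\<^sup>2 + n2\<^sup>2) + C0 \<le> ennreal (min (n1\<^sup>2) (n2\<^sup>2) + c) + C1"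
          unfolding idle send iff by (rule ennreal_leI)
        then show ?thesis
          using \<open>e \<noteq> 0\<close> True by (simp add: best_cost_def action_cost_def min_absorb1)
      next
        case False
        then have "ennreal (min (n1\<^sup>2) (n2\<^sup>2) + c) + C1 \<le> ennreal (n1\<^sup>2 + n2\<^sup>2) + C0"
          unfolding idle send iff by (intro ennreal_leI) simp
        then have "best_cost c C0 C1 e (n1\<^sup>2) (n2\<^sup>2) = ennreal (min (n1\<^sup>2) (n2\<^sup>2) + c) + C1"
          using \<open>e \<noteq> 0\<close> by (simp add: best_cost_def min_absorb2)
        then show ?thesis
          using \<open>e \<noteq> 0\<close> False by (auto simp: action_cost_def min_sq)
      qed
    qed
  qed (simp add: action_cost_def best_cost_def)
qed

subsection \<open>Dynamic programming\<close>

context energy_harvesting_model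
begin

text \<open>Here \<open>e\<close> is the level after the decision has been paid for and before the
  harvest arrives.\<close>

definition next_cost :: "nat \<Rightarrow> (nat \<Rightarrow> ennreal) \<Rightarrow> nat \<Rightarrow> ennreal" where
  "next_cost B V e = (\<integral>\<^sup>+z. V (min (e + z) B) \<partial>measure_pmf pZ)"

text \<open>Dynamic programming operator of the scheduling problem in which the no-packet estimates
  are frozen at \<open>a1\<close> and \<open>a2\<close>. At \<open>e = 0\<close> natural subtraction
  gives \<open>e - 1 = 0\<close>, and \<open>best_cost\<close> offers only the idle branch
  there.\<close>

definition bellman :: "nat \<Rightarrow> real \<Rightarrow> 'a \<Rightarrow> 'b \<Rightarrow> (nat \<Rightarrow> ennreal) \<Rightarrow> nat \<Rightarrow> ennreal" where
  "bellman B c a1 a2 V e =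
     (\<integral>\<^sup>+x. best_cost c (next_cost B V e) (next_cost B V (e - 1)) e
       ((norm (fst x - a1))\<^sup>2) ((norm (snd x - a2))\<^sup>2) \<partial>source_law)"

text \<open>The index \<open>k\<close> counts the stages still to be played: the level at the start
  of stage \<open>t\<close> is valued with \<open>k = T - t + 1\<close>.\<close>

definition cost_to_go :: "nat \<Rightarrow> real \<Rightarrow> 'a \<Rightarrow> 'b \<Rightarrow> nat \<Rightarrow> nat \<Rightarrow> ennreal" where
  "cost_to_go B c a1 a2 k = (bellman B c a1 a2 ^^ k) (\<lambda>_. 0)"

lemma cost_to_go_simps:
  "cost_to_go B c a1 a2 0 = (\<lambda>_. 0)"
  "cost_to_go B c a1 a2 (Suc k) = bellman B c a1 a2 (cost_to_go B c a1 a2 k)"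
  by (simp_all add: cost_to_go_def)

text \<open>The place where symmetry and unimodality enter. \<open>b1\<close> and \<open>b2\<close>
  stand for whatever the estimators announce without a packet; the continuation \<open>V\<close>
  does not depend on them, so comparing the current stage is enough.\<close>

lemma bellman_le_best_cost:
  assumes "symmetric_unimodal \<pi>1 a1" "symmetric_unimodal \<pi>2 a2"
  shows "bellman B c a1 a2 V e \<le> (\<integral>\<^sup>+x. best_cost c (next_cost B V e) (next_cost B V (e - 1)) e
       ((norm (fst x - b1))\<^sup>2) ((norm (snd x - b2))\<^sup>2) \<partial>source_law)"
  unfolding bellman_def
proof (rule source_law_nn_integral_le[OF assms,
      of "\<lambda>u v. best_cost c (next_cost B V e) (next_cost B V (e - 1)) e (u\<^sup>2) (v\<^sup>2)"])
  show "case_prod (\<lambda>u v. best_cost c (next_cost B V e) (next_cost B V (e - 1)) e (u\<^sup>2) (v\<^sup>2))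
      \<in> borel_measurable (borel \<Otimes>\<^sub>M borel)"
    unfolding best_cost_def by measurable
qed (intro best_cost_mono power_mono)

section \<open>Infinite costs to go\<close>

abbreviation idle_cost :: "'a \<Rightarrow> 'b \<Rightarrow> ennreal" where
  "idle_cost a1 a2 \<equiv> \<integral>\<^sup>+x. ennreal ((norm (fst x - a1))\<^sup>2 + (norm (snd x - a2))\<^sup>2) \<partial>source_law"

text \<open>Never transmitting is possible at every battery level and costs the same at
  each.\<close>

lemma cost_to_go_le: "cost_to_go B c a1 a2 k e \<le> of_nat k * idle_cost a1 a2"
proof (induction k arbitrary: e)
  case (Suc k)
  interpret S: prob_space source_law by (rule prob_space_source_law)
  let ?V = "cost_to_go B c a1 a2 k"
  have "next_cost B ?V e \<le> (\<integral>\<^sup>+z. of_nat k * idle_cost a1 a2 \<partial>measure_pmf pZ)"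
    unfolding next_cost_def by (intro nn_integral_mono Suc)
  then have nxt: "next_cost B ?V e \<le> of_nat k * idle_cost a1 a2"
    by (simp add: measure_pmf.emeasure_space_1[simplified])
  have "cost_to_go B c a1 a2 (Suc k) e \<le>
      (\<integral>\<^sup>+x. ennreal ((norm (fst x - a1))\<^sup>2 + (norm (snd x - a2))\<^sup>2) + next_cost B ?V e \<partial>source_law)"
    unfolding cost_to_go_simps bellman_def
    by (intro nn_integral_mono) (auto simp: best_cost_def)
  also have "\<dots> = idle_cost a1 a2 + next_cost B ?V e"
    by (subst nn_integral_add) (auto simp: S.emeasure_space_1)
  also have "\<dots> \<le> idle_cost a1 a2 + of_nat k * idle_cost a1 a2"
    by (intro add_left_mono nxt)
  finally show ?case by (simp add: algebra_simps)
qed (simp add: cost_to_go_simps)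

text \<open>By \<open>cost_to_go_le\<close> an infinite continuation forces a single idle stage to
  have infinite cost. If transmitting leads to infinity, \<open>best_cost\<close> is at least the
  idle stage cost, so the value before the decision is already infinite.\<close>

lemma cost_to_go_unreachable:
  assumes V: "V = cost_to_go B c a1 a2 k" and "e \<noteq> 0" and inf: "next_cost B V (e - 1) = \<infinity>"
  shows "bellman B c a1 a2 V e = \<infinity>"
proof -
  have "next_cost B V (e - 1) \<le> (\<integral>\<^sup>+z. of_nat k * idle_cost a1 a2 \<partial>measure_pmf pZ)"
    unfolding next_cost_def V by (intro nn_integral_mono cost_to_go_le)
  then have "of_nat k * idle_cost a1 a2 = \<infinity>"
    using inf by (simp add: measure_pmf.emeasure_space_1[simplified] top_unique)
  then have "idle_cost a1 a2 = \<infinity>"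
    by (auto simp: ennreal_mult_eq_top_iff)
  moreover have "idle_cost a1 a2 \<le> bellman B c a1 a2 V e"
    unfolding bellman_def by (intro nn_integral_mono) (use assms in \<open>auto simp: best_cost_def\<close>)
  ultimately show ?thesis by (simp add: top_unique)
qed

text \<open>The energy of the step is integrated out first. Decision and stage cost do not read it,
  so \<open>w'\<close> may carry the dummy energy 0; averaging the next battery level alone produces
  \<open>next_cost\<close>.\<close>

lemma path_step:
  fixes f :: "('a, 'b) scheduler"
  assumes f: "measurable_scheduler T f" and n: "Suc n \<le> T"
    and g: "admissible_estimator T g1" "admissible_estimator T g2"
    and w: "w \<in> space (path_space n)"
  defines "w' \<equiv> \<lambda>x. w(Suc n := (x, 0))"
  shows "(\<integral>\<^sup>+y. stage_cost B c f g1 g2 (Suc n) (w(Suc n := y)) +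
        V (path_battery B f (w(Suc n := y)) (Suc (Suc n))) \<partial>step_law) =
    (\<integral>\<^sup>+x. stage_cost B c f g1 g2 (Suc n) (w' x) +
        next_cost B V (path_battery B f w (Suc n) - (if path_decision B f (w' x) (Suc n) \<noteq> 0 then 1 else 0))
      \<partial>source_law)"
proof -
  let ?t = "Suc n"
  have ins: "{1..Suc n} = insert (Suc n) {1..n}" by auto
  have upd: "(\<lambda>y. w(?t := y)) \<in> measurable ((borel \<Otimes>\<^sub>M borel) \<Otimes>\<^sub>M count_space UNIV) (path_space ?t)"
    unfolding ins using w by (intro measurable_component_update) auto
  have [measurable]: "(\<lambda>y. stage_cost B c f g1 g2 ?t (w(?t := y))) \<in>
      borel_measurable ((borel \<Otimes>\<^sub>M borel) \<Otimes>\<^sub>M count_space UNIV)"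
    using n by (intro measurable_compose[OF upd] measurable_stage_cost[OF f _ _ g]) auto
  have [measurable]: "(\<lambda>y. path_battery B f (w(?t := y)) (Suc ?t)) \<in>
      measurable ((borel \<Otimes>\<^sub>M borel) \<Otimes>\<^sub>M count_space UNIV) (count_space UNIV)"
    using n by (intro measurable_compose[OF upd] measurable_path_battery[OF f]) auto
  have stage: "stage_cost B c f g1 g2 ?t (w(?t := (x, z))) = stage_cost B c f g1 g2 ?t (w' x)" for x z
    unfolding w'_def by (rule stage_cost_cong) auto
  have bat: "path_battery B f (w(?t := (x, z))) (Suc ?t) =
      min (path_battery B f w ?t - (if path_decision B f (w' x) ?t \<noteq> 0 then 1 else 0) + z) B" for x z
  proof -
    have "path_battery B f (w(?t := (x, z))) ?t = path_battery B f w ?t"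
      by (rule battery_cong) auto
    moreover have "path_decision B f (w(?t := (x, z))) ?t = path_decision B f (w' x) ?t"
      unfolding w'_def by (rule decision_cong) auto
    ultimately show ?thesis by simp
  qed
  have "(\<lambda>y. stage_cost B c f g1 g2 ?t (w(?t := y)) + V (path_battery B f (w(?t := y)) (Suc ?t)))
      \<in> borel_measurable ((borel \<Otimes>\<^sub>M borel) \<Otimes>\<^sub>M count_space UNIV)"
    by measurable
  then have meas: "(\<lambda>y. stage_cost B c f g1 g2 ?t (w(?t := y)) + V (path_battery B f (w(?t := y)) (Suc ?t)))
      \<in> borel_measurable (source_law \<Otimes>\<^sub>M measure_pmf pZ)"
    by (simp only: step_law_def[symmetric] measurable_cong_sets[OF sets_step_law refl])
  have "(\<integral>\<^sup>+y. stage_cost B c f g1 g2 ?t (w(?t := y)) +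
        V (path_battery B f (w(?t := y)) (Suc ?t)) \<partial>step_law) =
      (\<integral>\<^sup>+x. \<integral>\<^sup>+z. stage_cost B c f g1 g2 ?t (w(?t := (x, z))) +
        V (path_battery B f (w(?t := (x, z))) (Suc ?t)) \<partial>measure_pmf pZ \<partial>source_law)"
    unfolding step_law_def
    by (rule measure_pmf.nn_integral_fst[OF meas, symmetric])
  also have "\<dots> = (\<integral>\<^sup>+x. stage_cost B c f g1 g2 ?t (w' x) +
        next_cost B V (path_battery B f w ?t - (if path_decision B f (w' x) ?t \<noteq> 0 then 1 else 0))
      \<partial>source_law)"
    unfolding stage bat next_cost_def
    by (subst nn_integral_add) (simp_all add: measure_pmf.emeasure_space_1[simplified])
  finally show ?thesis .
qed

text \<open>With the past \<open>w\<close> frozen, each estimator's answer to a missing packet is a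
  fixed point that cannot vary with the current sources. For every \<open>x\<close> the true cost
  therefore dominates \<open>action_cost\<close> for these points, hence also the cost of the best
  decision against them.\<close>

lemma path_step_ge:
  fixes f :: "('a, 'b) scheduler"
  assumes "0 \<le> c" and su: "symmetric_unimodal \<pi>1 a1" "symmetric_unimodal \<pi>2 a2"
    and f: "measurable_scheduler T f" "feasible_scheduler B f" and n: "Suc n \<le> T"
    and g: "admissible_estimator T g1" "admissible_estimator T g2"
    and w: "w \<in> space (path_space n)"
  shows "bellman B c a1 a2 V (path_battery B f w (Suc n)) \<le>
    (\<integral>\<^sup>+y. stage_cost B c f g1 g2 (Suc n) (w(Suc n := y)) +
        V (path_battery B f (w(Suc n := y)) (Suc (Suc n))) \<partial>step_law)"
proof -
  let ?t = "Suc n" and ?e = "path_battery B f w (Suc n)"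
  define w' where "w' x = w(?t := (x, 0))" for x
  \<comment> \<open>The answer to a history that ends with a missing packet. Only entries of
    \<open>w\<close> up to time \<open>n\<close> matter, so no current source enters.\<close>
  define b1 where "b1 = g1 ?t (\<lambda>s\<in>{1..?t}. if s = ?t then None else observe 1 (path_decision B f w s) (fst (fst (w s))))"
  define b2 where "b2 = g2 ?t (\<lambda>s\<in>{1..?t}. if s = ?t then None else observe 2 (path_decision B f w s) (snd (fst (w s))))"
  have cost: "best_cost c (next_cost B V ?e) (next_cost B V (?e - 1)) ?e
        ((norm (fst x - b1))\<^sup>2) ((norm (snd x - b2))\<^sup>2) \<le>
      stage_cost B c f g1 g2 ?t (w' x) +
        next_cost B V (?e - (if path_decision B f (w' x) ?t \<noteq> 0 then 1 else 0))" for x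
  proof -
    let ?u = "path_decision B f (w' x) ?t"
    have dec: "path_decision B f (w' x) s = path_decision B f w s" if "s \<in> {1..n}" for s
      using that unfolding w'_def by (intro decision_cong) auto
    have "path_battery B f (w' x) ?t = ?e"
      unfolding w'_def by (intro battery_cong) auto
    moreover have "?u \<in> decisions (path_battery B f (w' x) ?t)"
      using f(2) unfolding feasible_scheduler_def by (simp del: battery.simps)
    ultimately have u: "?u \<in> decisions ?e" by metis
    have obs1: "(\<lambda>s\<in>{1..?t}. observe 1 (path_decision B f (w' x) s) (fst (fst (w' x s)))) =
        (\<lambda>s\<in>{1..?t}. if s = ?t then None else observe 1 (path_decision B f w s) (fst (fst (w s))))" if "?u \<noteq> 1"
      using that dec by (intro restrict_ext) (auto simp: observe_def w'_def)
    have obs2: "(\<lambda>s\<in>{1..?t}. observe 2 (path_decision B f (w' x) s) (snd (fst (w' x s)))) =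
        (\<lambda>s\<in>{1..?t}. if s = ?t then None else observe 2 (path_decision B f w s) (snd (fst (w s))))" if "?u \<noteq> 2"
      using that dec by (intro restrict_ext) (auto simp: observe_def w'_def)
    have src: "fst (w' x ?t) = x" by (simp add: w'_def)
    have "best_cost c (next_cost B V ?e) (next_cost B V (?e - 1)) ?e
        ((norm (fst x - b1))\<^sup>2) ((norm (snd x - b2))\<^sup>2) \<le>
      action_cost c (next_cost B V ?e) (next_cost B V (?e - 1)) ?u
        ((norm (fst x - b1))\<^sup>2) ((norm (snd x - b2))\<^sup>2)"
      using u by (rule best_cost_le_action_cost)
    \<comment> \<open>A source that is not transmitted is estimated by exactly \<open>b1\<close> or
      \<open>b2\<close>. The error on a transmitted one is only bounded below by 0, as an estimator
      is free to ignore its packet.\<close>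
    also have "\<dots> \<le> stage_cost B c f g1 g2 ?t (w' x) +
        next_cost B V (?e - (if ?u \<noteq> 0 then 1 else 0))"
    proof -
      consider "?u = 0" | "?u = 1" | "?u = 2"
        using u by (auto simp: decisions_def split: if_splits)
      then show ?thesis
      proof cases
        case 1
        then show ?thesis
          using obs1 obs2 unfolding stage_cost_def src b1_def b2_def
          by (simp add: action_cost_def del: battery.simps)
      next
        case 2
        then show ?thesis
          using obs2 \<open>0 \<le> c\<close> unfolding stage_cost_def src b1_def b2_def
          by (auto simp: action_cost_def simp del: battery.simps intro!: add_right_mono ennreal_leI)
      next
        case 3
        then show ?thesis
          using obs1 \<open>0 \<le> c\<close> unfolding stage_cost_def src b1_def b2_def
          by (auto simp: action_cost_def simp del: battery.simps intro!: add_right_mono ennreal_leI)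
      qed
    qed
    finally show ?thesis .
  qed
  have "bellman B c a1 a2 V ?e \<le> (\<integral>\<^sup>+x. best_cost c (next_cost B V ?e) (next_cost B V (?e - 1)) ?e
       ((norm (fst x - b1))\<^sup>2) ((norm (snd x - b2))\<^sup>2) \<partial>source_law)"
    by (rule bellman_le_best_cost[OF su])
  also have "\<dots> \<le> (\<integral>\<^sup>+x. stage_cost B c f g1 g2 ?t (w' x) +
        next_cost B V (?e - (if path_decision B f (w' x) ?t \<noteq> 0 then 1 else 0)) \<partial>source_law)"
    by (intro nn_integral_mono cost)
  also have "\<dots> = (\<integral>\<^sup>+y. stage_cost B c f g1 g2 ?t (w(?t := y)) +
        V (path_battery B f (w(?t := y)) (Suc ?t)) \<partial>step_law)"
    unfolding w'_def by (rule path_step[OF f(1) n g w, symmetric])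
  finally show ?thesis .
qed

text \<open>Built from the values after stage \<open>t\<close>, when \<open>T - t\<close> stages
  remain; the value to be attained at \<open>t\<close> has the next larger index.\<close>

definition optimal_thresholds :: "nat \<Rightarrow> real \<Rightarrow> 'a \<Rightarrow> 'b \<Rightarrow> nat \<Rightarrow> int \<Rightarrow> real" where
  "optimal_thresholds B c a1 a2 t i =
     optimal_threshold c (next_cost B (cost_to_go B c a1 a2 (T - t)) (nat i))
       (next_cost B (cost_to_go B c a1 a2 (T - t)) (nat i - 1))"

abbreviation optimal_scheduler :: "nat \<Rightarrow> real \<Rightarrow> 'a \<Rightarrow> 'b \<Rightarrow> ('a, 'b) scheduler" where
  "optimal_scheduler B c a1 a2 \<equiv> threshold_scheduler a1 a2 (optimal_thresholds B c a1 a2)"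

text \<open>The lower bound by \<open>action_cost\<close> becomes an equality: this estimator copies
  a received packet and otherwise announces the centre.\<close>

lemma stage_cost_default:
  fixes f :: "('a, 'b) scheduler"
  assumes t: "1 \<le> t" and e: "e = path_battery B f w t" and x: "x = fst (w t)"
    and u: "u = path_decision B f w t" "u \<in> decisions e"
  shows "stage_cost B c f (default_estimator a1) (default_estimator a2) t w +
      next_cost B V (e - (if u \<noteq> 0 then 1 else 0)) =
    action_cost c (next_cost B V e) (next_cost B V (e - 1)) u
      ((norm (fst x - a1))\<^sup>2) ((norm (snd x - a2))\<^sup>2)"
proof -
  have t': "t \<in> {1..t}" using t by simp
  consider "u = 0" | "u = 1" | "u = 2"
    using u(2) by (auto simp: decisions_def split: if_splits)
  then show ?thesis
    unfolding stage_cost_def default_estimator_def restrict_apply'[OF t'] u(1)[symmetric] x[symmetric]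
    by cases (simp_all add: action_cost_def observe_def)
qed

text \<open>The estimates in the absence of a packet are the centres themselves, and the threshold
  rule picks a pointwise minimiser, so outside the infinite case the estimates in
  \<open>path_step_ge\<close> are attained.\<close>

lemma path_step_optimal:
  fixes a1 :: 'a and a2 :: 'b and B n :: nat and c :: real
  assumes "0 \<le> c" and n: "Suc n \<le> T" and w: "w \<in> space (path_space n)"
  defines "f \<equiv> optimal_scheduler B c a1 a2"
    and "V \<equiv> cost_to_go B c a1 a2 (T - Suc n)"
  shows "(\<integral>\<^sup>+y. stage_cost B c f (default_estimator a1) (default_estimator a2) (Suc n) (w(Suc n := y)) +
        V (path_battery B f (w(Suc n := y)) (Suc (Suc n))) \<partial>step_law) \<le>
    bellman B c a1 a2 V (path_battery B f w (Suc n))"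
proof (cases "path_battery B f w (Suc n) \<noteq> 0 \<and>
    next_cost B V (path_battery B f w (Suc n) - 1) = \<infinity>")
  \<comment> \<open>No real threshold expresses "never transmit", but here the bound itself is
    infinite.\<close>
  case True
  then show ?thesis
    using cost_to_go_unreachable[of V B c a1 a2 "T - Suc n" "path_battery B f w (Suc n)"]
    by (simp add: V_def del: battery.simps)
next
  case False
  let ?t = "Suc n" and ?e = "path_battery B f w (Suc n)"
  define w' where "w' x = w(?t := (x, 0))" for x
  have f: "measurable_scheduler T f"
    unfolding f_def by (rule measurable_threshold_scheduler)
  have "stage_cost B c f (default_estimator a1) (default_estimator a2) ?t (w' x) +
        next_cost B V (?e - (if path_decision B f (w' x) ?t \<noteq> 0 then 1 else 0)) =
      best_cost c (next_cost B V ?e) (next_cost B V (?e - 1)) ?e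
        ((norm (fst x - a1))\<^sup>2) ((norm (snd x - a2))\<^sup>2)" for x
  proof -
    have e: "path_battery B f (w' x) ?t = ?e"
      unfolding w'_def by (intro battery_cong) auto
    have x: "fst (w' x ?t) = x" by (simp add: w'_def)
    have u: "path_decision B f (w' x) ?t = threshold_rule a1 a2 (optimal_thresholds B c a1 a2) ?t x ?e"
      using e x unfolding f_def by (subst decision_threshold) (auto simp del: battery.simps)
    have "stage_cost B c f (default_estimator a1) (default_estimator a2) ?t (w' x) +
        next_cost B V (?e - (if path_decision B f (w' x) ?t \<noteq> 0 then 1 else 0)) =
      action_cost c (next_cost B V ?e) (next_cost B V (?e - 1)) (path_decision B f (w' x) ?t)
        ((norm (fst x - a1))\<^sup>2) ((norm (snd x - a2))\<^sup>2)"
      by (rule stage_cost_default[OF _ e[symmetric] x[symmetric] refl])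
        (simp, simp only: u threshold_rule_in_decisions)
    also have "\<dots> = best_cost c (next_cost B V ?e) (next_cost B V (?e - 1)) ?e
        ((norm (fst x - a1))\<^sup>2) ((norm (snd x - a2))\<^sup>2)"
      \<comment> \<open>The excluded case is what supplies the premise of
        \<open>action_cost_threshold\<close> on infinite costs.\<close>
      unfolding u using False \<open>0 \<le> c\<close>
      by (intro action_cost_threshold) (auto simp: optimal_thresholds_def V_def simp del: battery.simps)
    finally show ?thesis .
  qed
  then show ?thesis
    unfolding path_step[OF f n admissible_default_estimator admissible_default_estimator w] bellman_def
      w'_def by simp
qed

section \<open>Costs as integrals over finite powers of the one-step law\<close>

lemma sets_paths: "sets (PiM {1..n} (\<lambda>_. step_law)) = sets (path_space n)"
  by (intro sets_PiM_cong sets_step_law refl)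

lemma nn_integral_path_Suc:
  assumes "h \<in> borel_measurable (path_space (Suc n))"
  shows "(\<integral>\<^sup>+w. h w \<partial>PiM {1..Suc n} (\<lambda>_. step_law)) =
    (\<integral>\<^sup>+w. \<integral>\<^sup>+y. h (w(Suc n := y)) \<partial>step_law \<partial>PiM {1..n} (\<lambda>_. step_law))"
proof -
  interpret product_prob_space "\<lambda>_. step_law"
    by (intro product_prob_spaceI prob_space_step_law)
  have ins: "{1..Suc n} = insert (Suc n) {1..n}" by auto
  show ?thesis
    using assms unfolding ins
    by (intro product_nn_integral_insert)
      (simp_all only: ins[symmetric] measurable_cong_sets[OF sets_paths refl], simp_all)
qed

text \<open>Both terms depend on the first \<open>Suc n\<close> steps only, so they can share one
  integral; with the last step innermost it has the form that \<open>path_step_ge\<close> and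
  \<open>path_step_optimal\<close> estimate.\<close>

lemma nn_integral_stage_add:
  fixes f :: "('a, 'b) scheduler"
  assumes f: "measurable_scheduler T f" and n: "Suc n \<le> T"
    and g: "admissible_estimator T g1" "admissible_estimator T g2"
  shows "(\<integral>\<^sup>+w. stage_cost B c f g1 g2 (Suc n) w \<partial>PiM {1..Suc n} (\<lambda>_. step_law)) +
      (\<integral>\<^sup>+w. V (path_battery B f w (Suc (Suc n))) \<partial>PiM {1..Suc n} (\<lambda>_. step_law)) =
    (\<integral>\<^sup>+w. \<integral>\<^sup>+y. stage_cost B c f g1 g2 (Suc n) (w(Suc n := y)) +
        V (path_battery B f (w(Suc n := y)) (Suc (Suc n))) \<partial>step_law \<partial>PiM {1..n} (\<lambda>_. step_law))"
proof -
  have st: "stage_cost B c f g1 g2 (Suc n) \<in> borel_measurable (path_space (Suc n))"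
    using n by (intro measurable_stage_cost[OF f _ _ g]) auto
  have "(\<lambda>w. path_battery B f w (Suc (Suc n))) \<in> measurable (path_space (Suc n)) (count_space UNIV)"
    by (rule measurable_path_battery[OF f n]) simp
  then have bat: "(\<lambda>w. V (path_battery B f w (Suc (Suc n)))) \<in> borel_measurable (path_space (Suc n))"
    by (rule measurable_compose) simp
  show ?thesis
    by (subst nn_integral_path_Suc[symmetric])
      (use st bat in \<open>auto intro!: borel_measurable_add nn_integral_add[symmetric]
        simp: measurable_cong_sets[OF sets_paths refl] simp del: battery.simps\<close>)
qed

text \<open>Stage \<open>t\<close> reads only the first \<open>t\<close> steps, so each summand gets
  a product space of its own length; \<open>nn_integral_path_Suc\<close> links consecutive
  ones.\<close>

lemma total_cost_eq:
  fixes f :: "('a, 'b) scheduler"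
  assumes f: "measurable_scheduler T f"
    and g: "admissible_estimator T g1" "admissible_estimator T g2"
  shows "total_cost M T B c X1 X2 Z f g1 g2 =
    (\<Sum>t=1..T. \<integral>\<^sup>+w. stage_cost B c f g1 g2 t w \<partial>PiM {1..t} (\<lambda>_. step_law))"
  unfolding total_cost_def
proof (rule sum.cong[OF refl])
  fix t assume t: "t \<in> {1..T}"
  let ?W = "\<lambda>\<omega> s. ((X1 s \<omega>, X2 s \<omega>), Z s \<omega>)"
  have W: "(\<lambda>\<omega>. \<lambda>s\<in>{1..t}. ?W \<omega> s) \<in> measurable M (path_space t)"
  proof (rule measurable_restrict)
    fix s assume "s \<in> {1..t}"
    then have "s \<in> {1..T}" using t by auto
    then have [measurable]: "X1 s \<in> borel_measurable M" "X2 s \<in> borel_measurable M"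
      "Z s \<in> measurable M (count_space UNIV)"
      using X1_indep X2_indep Z_indep by (auto simp: indep_vars_def)
    show "(\<lambda>\<omega>. ?W \<omega> s) \<in> measurable M ((borel \<Otimes>\<^sub>M borel) \<Otimes>\<^sub>M count_space UNIV)"
      by measurable
  qed
  have st: "stage_cost B c f g1 g2 t \<in> borel_measurable (path_space t)"
    using t by (intro measurable_stage_cost[OF f _ _ g]) auto
  have "(\<integral>\<^sup>+w. stage_cost B c f g1 g2 t w \<partial>PiM {1..t} (\<lambda>_. step_law)) =
      (\<integral>\<^sup>+\<omega>. stage_cost B c f g1 g2 t (\<lambda>s\<in>{1..t}. ?W \<omega> s) \<partial>M)"
    unfolding path_law[OF t, symmetric]
    by (rule nn_integral_distr[OF W]) (simp only: measurable_distr_eq1 st)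
  \<comment> \<open>The restriction that placed the path in the product space is removed by
    causality.\<close>
  also have "\<dots> = (\<integral>\<^sup>+\<omega>. stage_cost B c f g1 g2 t (?W \<omega>) \<partial>M)"
    using t by (intro nn_integral_cong stage_cost_cong) auto
  finally show "(\<integral>\<^sup>+\<omega>. ennreal ((norm (X1 t \<omega> - estimate1_rv B X1 X2 Z f g1 t \<omega>))\<^sup>2 +
      (norm (X2 t \<omega> - estimate2_rv B X1 X2 Z f g2 t \<omega>))\<^sup>2 +
      c * (if decision_rv B X1 X2 Z f t \<omega> \<noteq> 0 then 1 else 0)) \<partial>M) =
    (\<integral>\<^sup>+w. stage_cost B c f g1 g2 t w \<partial>PiM {1..t} (\<lambda>_. step_law))"
    by (simp add: stage_cost_def estimate1_rv_def estimate2_rv_def decision_rv_def)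
qed

section \<open>Telescoping over time\<close>

lemma nn_integral_no_steps: "(\<integral>\<^sup>+w. V (path_battery B f w (Suc 0)) \<partial>PiM {1..0} (\<lambda>_. step_law)) = V B"
proof -
  interpret P0: prob_space "PiM {1..0::nat} (\<lambda>_. step_law)"
    by (intro prob_space_PiM prob_space_step_law)
  show ?thesis by (simp only: battery.simps nn_integral_const P0.emeasure_space_1 mult_1_right)
qed

text \<open>The backward recursion is contained in \<open>cost_to_go\<close>; the verification runs
  forward. The cost of the first \<open>n\<close> stages plus the expected cost to go after them can
  only grow with \<open>n\<close>; it equals the left side at \<open>n = 0\<close> and the total
  cost at \<open>n = T\<close>.\<close>

lemma cost_to_go_le_total_cost:
  fixes f :: "('a, 'b) scheduler"
  assumes "0 \<le> c" and su: "symmetric_unimodal \<pi>1 a1" "symmetric_unimodal \<pi>2 a2"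
    and f: "measurable_scheduler T f" "feasible_scheduler B f"
    and g: "admissible_estimator T g1" "admissible_estimator T g2"
  shows "cost_to_go B c a1 a2 T B \<le> total_cost M T B c X1 X2 Z f g1 g2"
proof -
  let ?P = "\<lambda>n. PiM {1..n} (\<lambda>_. step_law)" and ?V = "cost_to_go B c a1 a2"
  let ?G = "\<lambda>t. \<integral>\<^sup>+w. stage_cost B c f g1 g2 t w \<partial>?P t"
  have "cost_to_go B c a1 a2 T B \<le>
      (\<Sum>t=1..n. ?G t) + (\<integral>\<^sup>+w. ?V (T - n) (path_battery B f w (Suc n)) \<partial>?P n)" if "n \<le> T" for n
    using that
  proof (induction n)
    case 0
    then show ?case using nn_integral_no_steps by simp
  next
    case (Suc n)
    have V: "?V (T - n) = bellman B c a1 a2 (?V (T - Suc n))"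
      using Suc.prems by (simp add: cost_to_go_simps(2)[symmetric] Suc_diff_Suc)
    have "(\<integral>\<^sup>+w. ?V (T - n) (path_battery B f w (Suc n)) \<partial>?P n) \<le>
        ?G (Suc n) + (\<integral>\<^sup>+w. ?V (T - Suc n) (path_battery B f w (Suc (Suc n))) \<partial>?P (Suc n))"
      unfolding nn_integral_stage_add[OF f(1) Suc.prems g] V
      using sets_eq_imp_space_eq[OF sets_paths]
      by (intro nn_integral_mono path_step_ge[OF \<open>0 \<le> c\<close> su f Suc.prems g]) simp
    then have "(\<Sum>t=1..n. ?G t) + (\<integral>\<^sup>+w. ?V (T - n) (path_battery B f w (Suc n)) \<partial>?P n) \<le>
        (\<Sum>t=1..Suc n. ?G t) + (\<integral>\<^sup>+w. ?V (T - Suc n) (path_battery B f w (Suc (Suc n))) \<partial>?P (Suc n))"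
      by (simp add: add.assoc add_left_mono del: battery.simps)
    moreover have "n \<le> T" using Suc.prems by simp
    ultimately show ?case using Suc.IH by (blast intro: order_trans)
  qed
  from this[of T] show ?thesis
    unfolding total_cost_eq[OF f(1) g] by (simp add: cost_to_go_simps)
qed

text \<open>The same telescoping quantity, which under the optimal profile can only decrease with
  \<open>n\<close>.\<close>

lemma total_cost_optimal_le:
  assumes "0 \<le> c"
  shows "total_cost M T B c X1 X2 Z (optimal_scheduler B c a1 a2) (default_estimator a1) (default_estimator a2)
    \<le> cost_to_go B c a1 a2 T B"
proof -
  let ?f = "optimal_scheduler B c a1 a2" and ?g1 = "default_estimator a1" and ?g2 = "default_estimator a2"
  let ?P = "\<lambda>n. PiM {1..n} (\<lambda>_. step_law)" and ?V = "cost_to_go B c a1 a2"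
  let ?G = "\<lambda>t. \<integral>\<^sup>+w. stage_cost B c ?f ?g1 ?g2 t w \<partial>?P t"
  note f = measurable_threshold_scheduler[of T a1 a2 "optimal_thresholds B c a1 a2"]
  note g = admissible_default_estimator[of T a1] admissible_default_estimator[of T a2]
  have "(\<Sum>t=1..n. ?G t) + (\<integral>\<^sup>+w. ?V (T - n) (path_battery B ?f w (Suc n)) \<partial>?P n) \<le>
      cost_to_go B c a1 a2 T B" if "n \<le> T" for n
    using that
  proof (induction n)
    case 0
    then show ?case using nn_integral_no_steps by simp
  next
    case (Suc n)
    have V: "?V (T - n) = bellman B c a1 a2 (?V (T - Suc n))"
      using Suc.prems by (simp add: cost_to_go_simps(2)[symmetric] Suc_diff_Suc)
    have "?G (Suc n) + (\<integral>\<^sup>+w. ?V (T - Suc n) (path_battery B ?f w (Suc (Suc n))) \<partial>?P (Suc n)) \<le>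
        (\<integral>\<^sup>+w. ?V (T - n) (path_battery B ?f w (Suc n)) \<partial>?P n)"
      unfolding nn_integral_stage_add[OF f Suc.prems g] V
      using sets_eq_imp_space_eq[OF sets_paths]
      by (intro nn_integral_mono path_step_optimal[OF \<open>0 \<le> c\<close> Suc.prems]) simp
    then have "(\<Sum>t=1..Suc n. ?G t) + (\<integral>\<^sup>+w. ?V (T - Suc n) (path_battery B ?f w (Suc (Suc n))) \<partial>?P (Suc n)) \<le>
        (\<Sum>t=1..n. ?G t) + (\<integral>\<^sup>+w. ?V (T - n) (path_battery B ?f w (Suc n)) \<partial>?P n)"
      by (simp add: add.assoc add_left_mono del: battery.simps)
    moreover have "n \<le> T" using Suc.prems by simp
    ultimately show ?case using Suc.IH by (blast intro: order_trans)
  qed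
  from this[of T] show ?thesis
    unfolding total_cost_eq[OF f g] by (simp add: cost_to_go_simps)
qed

section \<open>Clipped competitors and the conclusion\<close>

lemma total_cost_clip_scheduler:
  assumes "admissible_scheduler M T B X1 X2 Z f"
  shows "total_cost M T B c X1 X2 Z (clip_scheduler f) g1 g2 = total_cost M T B c X1 X2 Z f g1 g2"
  unfolding total_cost_def
proof (intro sum.cong[OF refl] nn_integral_cong)
  fix t \<omega> assume t: "t \<in> {1..T}" and \<omega>: "\<omega> \<in> space M"
  have dec: "decision_rv B X1 X2 Z (clip_scheduler f) s \<omega> = decision_rv B X1 X2 Z f s \<omega>" if "s \<in> {1..t}" for s
    unfolding decision_rv_def
    using assms \<omega> that t
    by (intro clip_scheduler_eq[of T]) (auto simp: admissible_scheduler_def decision_rv_def battery_rv_def)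
  have "t \<in> {1..t}" using t by simp
  moreover have "estimate1_rv B X1 X2 Z (clip_scheduler f) g1 t \<omega> = estimate1_rv B X1 X2 Z f g1 t \<omega>"
    "estimate2_rv B X1 X2 Z (clip_scheduler f) g2 t \<omega> = estimate2_rv B X1 X2 Z f g2 t \<omega>"
    unfolding estimate1_rv_def estimate2_rv_def
    by (intro arg_cong[where f = "g1 t"] arg_cong[where f = "g2 t"] restrict_ext; simp only: dec)+
  ultimately show "ennreal ((norm (X1 t \<omega> - estimate1_rv B X1 X2 Z (clip_scheduler f) g1 t \<omega>))\<^sup>2 +
      (norm (X2 t \<omega> - estimate2_rv B X1 X2 Z (clip_scheduler f) g2 t \<omega>))\<^sup>2 +
      c * (if decision_rv B X1 X2 Z (clip_scheduler f) t \<omega> \<noteq> 0 then 1 else 0)) =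
    ennreal ((norm (X1 t \<omega> - estimate1_rv B X1 X2 Z f g1 t \<omega>))\<^sup>2 +
      (norm (X2 t \<omega> - estimate2_rv B X1 X2 Z f g2 t \<omega>))\<^sup>2 +
      c * (if decision_rv B X1 X2 Z f t \<omega> \<noteq> 0 then 1 else 0))"
    by (simp only: dec)
qed

lemma admissible_threshold_scheduler:
  "admissible_scheduler M T B X1 X2 Z (threshold_scheduler a1 a2 \<tau>)"
  using measurable_threshold_scheduler[of T a1 a2 \<tau>] feasible_threshold_scheduler[of B a1 a2 \<tau>]
  by (auto simp: admissible_scheduler_def measurable_scheduler_def feasible_scheduler_def
      decision_rv_def battery_rv_def)

text \<open>The value of \<open>cost_to_go\<close> for \<open>T\<close> stages and a full battery
  separates the two costs. The competitor is clipped first, at unchanged cost, so that it is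
  feasible on every path and the lower bound applies.\<close>

lemma threshold_scheduler_optimal:
  assumes "0 \<le> c" "symmetric_unimodal \<pi>1 a1" "symmetric_unimodal \<pi>2 a2"
    and f: "admissible_scheduler M T B X1 X2 Z f"
    and g: "admissible_estimator T g1" "admissible_estimator T g2"
  shows "total_cost M T B c X1 X2 Z (optimal_scheduler B c a1 a2) (default_estimator a1) (default_estimator a2)
    \<le> total_cost M T B c X1 X2 Z f g1 g2"
proof -
  have "measurable_scheduler T f"
    using f by (auto simp: admissible_scheduler_def measurable_scheduler_def)
  then have "cost_to_go B c a1 a2 T B \<le> total_cost M T B c X1 X2 Z (clip_scheduler f) g1 g2"
    using assms by (intro cost_to_go_le_total_cost measurable_clip_scheduler feasible_clip_scheduler)
  then show ?thesis
    using total_cost_optimal_le[OF \<open>0 \<le> c\<close>, of B a1 a2] total_cost_clip_scheduler[OF f]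
    by (metis order_trans)
qed

end

theorem theorem1:
  fixes M :: "'w measure"
    and T B :: nat
    and c :: real
    and X1 :: "nat \<Rightarrow> 'w \<Rightarrow> real ^ 'n1"
    and X2 :: "nat \<Rightarrow> 'w \<Rightarrow> real ^ 'n2"
    and Z :: "nat \<Rightarrow> 'w \<Rightarrow> nat"
    and \<pi>1 :: "real ^ 'n1 \<Rightarrow> real"
    and \<pi>2 :: "real ^ 'n2 \<Rightarrow> real"
    and pZ :: "nat pmf"
    and a1 :: "real ^ 'n1"
    and a2 :: "real ^ 'n2"
  assumes "1 \<le> B" and "B < T" and "0 \<le> c"
    and "energy_harvesting_model M T X1 X2 Z \<pi>1 \<pi>2 pZ"
    and "symmetric_unimodal \<pi>1 a1"
    and "symmetric_unimodal \<pi>2 a2"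
  shows "\<exists>\<tau> :: nat \<Rightarrow> int \<Rightarrow> real.
    admissible_scheduler M T B X1 X2 Z (threshold_scheduler a1 a2 \<tau>) \<and>
    admissible_estimator T (default_estimator a1) \<and>
    admissible_estimator T (default_estimator a2) \<and>
    (\<forall>f g1 g2.
      admissible_scheduler M T B X1 X2 Z f \<and> admissible_estimator T g1 \<and> admissible_estimator T g2 \<longrightarrow>
      total_cost M T B c X1 X2 Z (threshold_scheduler a1 a2 \<tau>) (default_estimator a1) (default_estimator a2)
        \<le> total_cost M T B c X1 X2 Z f g1 g2)"
proof -
  interpret energy_harvesting_model M T X1 X2 Z \<pi>1 \<pi>2 pZ by fact
  show ?thesis
    using assms(3,5,6)
    by (intro exI[of _ "optimal_thresholds B c a1 a2"] conjI allI impI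
        admissible_threshold_scheduler admissible_default_estimator threshold_scheduler_optimal) auto
qed

end
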